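(* There exists an absolute constant $M>0$ such that for every prime $p$ and every proper subgroup $G$ of the multiplicative group $\mathbb{F}_p^*$ with $|G|>M$, there are no sets $A,B,C\subset\mathbb{F}_p$ with $|A|,|B|,|C|\ge2$ and $G=A+B+C$.
   Context: $\mathbb{F}_p$ is the field with $p$ elements. $A+B+C=\{a+b+c:a\in A,b\in B,c\in C\}$. *)

theory Defs
  imports "HOL-Number_Theory.Residues"
begin

end

theory Submission
  imports Defs "Berlekamp_Zassenhaus.Finite_Field" "HOL-Library.Set_Algebras"
begin

text \<open>Let \<open>d\<close> be the order of \<open>G\<close>. If \<open>A + B \<subseteq> G\<close>, the divided difference over \<open>t \<in> A\<close> of
  \<open>(x + t) ^ (d + |A| - 1)\<close>, a polynomial of degree \<open>d\<close>, takes the value 1 with multiplicity \<open>|A|\<close>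
  at every point of \<open>B\<close>, so \<open>|A| |B| \<le> d\<close> (Hanson and Petridis). Hence all sums in
  \<open>G = A + B + C\<close> are distinct, \<open>|A| |B| |C| = d\<close>, and the smallest summand, say \<open>A\<close>, satisfies
  \<open>|A| ^ 3 \<le> d\<close>. It remains to exclude \<open>G = A + B\<close> for such \<open>A\<close>.

  If \<open>|A| \<le> 3\<close>, the polynomial above is determined by its roots. Comparing its leading coefficients
  with the relations between the moments of \<open>A\<close> and \<open>B\<close> that come from the vanishing power sums of
  \<open>G\<close> makes all elements of \<open>A\<close> equal.

  If \<open>|A| \<ge> 4\<close>, Stepanov's method is applied to the polynomials
  \<open>\<Sum>s. P s * (\<Prod>a\<in>s. (x + a)) ^ d\<close>, where \<open>s\<close> runs over the sets of at most two elements of a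
  \<open>k\<close>-subset of \<open>A\<close>, with \<open>k\<close> a suitable multiple of \<open>sqrt |A|\<close>. The degree is about \<open>2 d\<close> and the
  vanishing order exceeds \<open>2 |A|\<close>, whence \<open>|B| < d / |A|\<close>. The auxiliary polynomial is not zero because the
  terms are independent even over the field of \<open>p\<close>-th powers, which is seen by adjoining the shifts
  \<open>a\<close> one at a time.\<close>

section \<open>Homogeneous systems and differential operators\<close>

text \<open>Gaussian elimination by cross-multiplication instead of division, so that it applies to
  systems with polynomial entries as well as to scalar ones.\<close>

lemma homogeneous_system_nontrivial:
  fixes M :: "'i \<Rightarrow> 'j \<Rightarrow> 'a::idom"
  assumes "finite J" "finite I" "card J < card I"
  shows "\<exists>g. (\<exists>i\<in>I. g i \<noteq> 0) \<and> (\<forall>j\<in>J. (\<Sum>i\<in>I. g i * M i j) = 0)"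
  using assms
proof (induction J arbitrary: I M rule: finite_induct)
  case empty
  then obtain i where "i \<in> I" by fastforce
  then show ?case by (intro exI[of _ "\<lambda>_. 1"]) auto
next
  case (insert j J)
  show ?case
  proof (cases "\<forall>i\<in>I. M i j = 0")
    case True
    then show ?thesis using insert.IH[of I M] insert by auto
  next
    case False
    then obtain k where k: "k \<in> I" "M k j \<noteq> 0" by blast
    let ?I = "I - {k}"
    have "card J < card ?I" using insert k by auto
    from insert.IH[OF _ this, of "\<lambda>i l. M k j * M i l - M i j * M k l"] obtain g where
      g: "\<exists>i\<in>?I. g i \<noteq> 0"
         "\<And>l. l \<in> J \<Longrightarrow> (\<Sum>i\<in>?I. g i * (M k j * M i l - M i j * M k l)) = 0"
      using insert.prems by auto
    define h where "h i = (if i = k then - (\<Sum>i\<in>?I. g i * M i j) else M k j * g i)" for i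
    have sum: "(\<Sum>i\<in>I. h i * M i l)
        = (\<Sum>i\<in>?I. g i * (M k j * M i l - M i j * M k l))" for l
    proof -
      have "(\<Sum>i\<in>I. h i * M i l) = h k * M k l + (\<Sum>i\<in>?I. h i * M i l)"
        using k insert.prems by (simp add: sum.remove)
      also have "(\<Sum>i\<in>?I. h i * M i l) = (\<Sum>i\<in>?I. M k j * g i * M i l)"
        by (intro sum.cong) (auto simp: h_def)
      also have "h k * M k l = - (\<Sum>i\<in>?I. g i * M i j * M k l)"
        by (simp add: h_def sum_distrib_right)
      finally show ?thesis
        by (simp add: sum_subtractf right_diff_distrib algebra_simps)
    qed
    have "\<forall>l\<in>insert j J. (\<Sum>i\<in>I. h i * M i l) = 0"
      using g(2) by (auto simp: sum algebra_simps)
    moreover have "\<exists>i\<in>I. h i \<noteq> 0" using g(1) k by (auto simp: h_def)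
    ultimately show ?thesis by blast
  qed
qed

text \<open>The factor \<open>U\<close> is mostly \<open>shift_prod A\<close>, which keeps
  polynomials of the form \<open>P * shift_prod s ^ d\<close> in that form; \<open>U = 1\<close>
  gives the ordinary derivative.\<close>

definition derivation_by :: "'a::idom poly \<Rightarrow> 'a poly \<Rightarrow> 'a poly" where
  "derivation_by U f = U * pderiv f"

lemma derivation_by_0 [simp]: "derivation_by U 0 = 0"
  by (simp add: derivation_by_def)

lemma derivation_by_add: "derivation_by U (f + g) = derivation_by U f + derivation_by U g"
  by (simp add: derivation_by_def pderiv_add algebra_simps)

lemma derivation_by_mult: "derivation_by U (f * g) = derivation_by U f * g + f * derivation_by U g"
  by (simp add: derivation_by_def pderiv_mult algebra_simps)

lemma derivation_by_sum: "derivation_by U (\<Sum>i\<in>I. f i) = (\<Sum>i\<in>I. derivation_by U (f i))"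
  by (induction I rule: infinite_finite_induct) (auto simp: derivation_by_add)

lemma derivation_by_iter_sum:
  "(derivation_by U ^^ j) (\<Sum>i\<in>I. f i) = (\<Sum>i\<in>I. (derivation_by U ^^ j) (f i))"
  by (induction j) (auto simp: derivation_by_sum)

text \<open>In characteristic \<open>p\<close> the constants are the polynomials with zero derivative, that is the
  polynomials in \<open>x ^ p\<close>. An operator of order \<open>r\<close> has at most \<open>r\<close> solutions that are independent
  over them; this replaces the Wronskian criterion.\<close>

lemma operator_solutions_dependent:
  fixes f :: "'i \<Rightarrow> 'a::field poly"
  assumes p: "prime CHAR('a)" and "finite I" and card: "r < card I"
    and U: "U \<noteq> 0" and br: "b r \<noteq> 0"
    and sol: "\<And>i. i \<in> I \<Longrightarrow> (\<Sum>j\<le>r. b j * (derivation_by U ^^ j) (f i)) = 0"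
  obtains C where "\<And>i. pderiv (C i) = 0" "\<exists>i\<in>I. C i \<noteq> 0" "(\<Sum>i\<in>I. C i * f i) = 0"
proof -
  let ?D = "derivation_by U"
  define rel where "rel g \<longleftrightarrow> (\<exists>i\<in>I. g i \<noteq> 0) \<and> (\<forall>j<r. (\<Sum>i\<in>I. g i * (?D ^^ j) (f i)) = 0)" for g
  define supp where "supp g = card {i\<in>I. g i \<noteq> (0 :: 'a poly)}" for g
  have "\<exists>g. rel g"
    using homogeneous_system_nontrivial[of "{..<r}" I "\<lambda>i j. (?D ^^ j) (f i)"] assms
    unfolding rel_def by auto
  \<comment> \<open>Minimal support drives the argument, as in Artin's proof of the independence of
    characters.\<close>
  then obtain g where g: "rel g" and min: "\<And>h. rel h \<Longrightarrow> supp g \<le> supp h"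
    using ex_has_least_nat[of rel _ supp] by auto
  have top: "(\<Sum>i\<in>I. g i * (?D ^^ j) (f i)) = 0" if "j \<le> r" for j
  proof (cases "j = r")
    case True
    have "0 = (\<Sum>i\<in>I. g i * (\<Sum>j\<le>r. b j * (?D ^^ j) (f i)))" using sol by simp
    also have "\<dots> = (\<Sum>j\<le>r. b j * (\<Sum>i\<in>I. g i * (?D ^^ j) (f i)))"
      by (simp add: sum_distrib_left mult.left_commute sum.swap[of _ I])
    also have "\<dots> = (\<Sum>j\<in>insert r {..<r}. b j * (\<Sum>i\<in>I. g i * (?D ^^ j) (f i)))"
      by (intro sum.cong) auto
    also have "\<dots> = b r * (\<Sum>i\<in>I. g i * (?D ^^ r) (f i))"
      using g by (simp add: rel_def)
    finally show ?thesis using br True by auto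
  next
    case False
    then show ?thesis using g that by (auto simp: rel_def)
  qed
  have diff: "(\<Sum>i\<in>I. ?D (g i) * (?D ^^ j) (f i)) = 0" if "j < r" for j
  proof -
    have "0 = ?D (\<Sum>i\<in>I. g i * (?D ^^ j) (f i))" using top[of j] that by simp
    also have "\<dots> = (\<Sum>i\<in>I. ?D (g i) * (?D ^^ j) (f i)) + (\<Sum>i\<in>I. g i * (?D ^^ Suc j) (f i))"
      by (simp add: derivation_by_sum derivation_by_mult sum.distrib)
    finally show ?thesis using top[of "Suc j"] that by simp
  qed
  obtain m where m: "m \<in> I" "g m \<noteq> 0" using g by (auto simp: rel_def)
  \<comment> \<open>Up to the factor \<open>U\<close>, the numerator of the derivative of
    \<open>g i / g m\<close>. It is again a relation but vanishes at \<open>m\<close>, so by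
    minimality it is zero on \<open>I\<close>.\<close>
  define h where "h i = g m * ?D (g i) - g i * ?D (g m)" for i
  have "(\<Sum>i\<in>I. h i * (?D ^^ j) (f i)) = 0" if "j < r" for j
  proof -
    have "(\<Sum>i\<in>I. h i * (?D ^^ j) (f i)) = g m * (\<Sum>i\<in>I. ?D (g i) * (?D ^^ j) (f i))
        - ?D (g m) * (\<Sum>i\<in>I. g i * (?D ^^ j) (f i))"
      by (simp add: h_def sum_distrib_left sum_subtractf[symmetric] algebra_simps)
    then show ?thesis using diff top that by simp
  qed
  moreover have "supp h < supp g"
    unfolding supp_def using m \<open>finite I\<close> by (intro psubset_card_mono) (auto simp: h_def)
  ultimately have h0: "h i = 0" if "i \<in> I" for i
    using min[of h] that unfolding rel_def by auto
  \<comment> \<open>The quotient \<open>g i / g m\<close> has zero derivative; multiplying by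
    \<open>g m ^ CHAR('a)\<close>, itself a constant, makes it a polynomial.\<close>
  define C where "C i = (if i \<in> I then g i * g m ^ (CHAR('a) - 1) else 0)" for i
  show thesis
  proof (rule that[of C])
    fix i
    have p2: "CHAR('a) \<ge> 2" using p by (simp add: prime_ge_2_nat)
    have minus1: "of_nat (CHAR('a) - 1) = (-1 :: 'a)"
      using p2 by simp
    show "pderiv (C i) = 0"
    proof (cases "i \<in> I")
      case True
      from h0[OF this] have eq: "g m * pderiv (g i) = g i * pderiv (g m)"
        using U by (simp add: h_def derivation_by_def algebra_simps)
      obtain q where q: "CHAR('a) - 1 = Suc q" using p2 by (cases "CHAR('a) - 1") auto
      have C: "C i = g i * g m ^ Suc q" unfolding C_def q using True by simp
      have "pderiv (C i) = g i * smult (of_nat (Suc q)) (g m ^ q * pderiv (g m)) + g m ^ Suc q * pderiv (g i)"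
        unfolding C by (simp only: pderiv_mult pderiv_power_Suc mult_smult_left)
      also have "\<dots> = g m ^ q * (g m * pderiv (g i) - g i * pderiv (g m))"
        unfolding minus1[unfolded q] by (simp add: algebra_simps)
      finally show ?thesis using eq by simp
    qed (simp add: C_def)
  next
    show "\<exists>i\<in>I. C i \<noteq> 0" using m by (intro bexI[of _ m]) (auto simp: C_def)
    have "(\<Sum>i\<in>I. C i * f i) = g m ^ (CHAR('a) - 1) * (\<Sum>i\<in>I. g i * f i)"
      unfolding sum_distrib_left by (intro sum.cong) (simp_all add: C_def)
    then show "(\<Sum>i\<in>I. C i * f i) = 0" using top[of 0] by simp
  qed
qed

section \<open>Independence of powers of shifted products\<close>

definition shift_prod :: "'a::idom set \<Rightarrow> 'a poly" where
  "shift_prod s = (\<Prod>a\<in>s. [:a, 1:])"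

text \<open>The operator that \<open>derivation_by (shift_prod A)\<close> induces on the cofactor
  \<open>P\<close> of \<open>shift_prod s ^ d\<close>; the factor \<open>shift_prod A\<close> clears
  the denominators of the logarithmic derivative.\<close>

definition twisted_derivation :: "'a::idom set \<Rightarrow> nat \<Rightarrow> 'a set \<Rightarrow> 'a poly \<Rightarrow> 'a poly" where
  "twisted_derivation A d s P =
     shift_prod A * pderiv P + smult (of_nat d) (shift_prod (A - s) * pderiv (shift_prod s)) * P"

lemma shift_prod_nonzero [simp]: "shift_prod s \<noteq> 0"
  unfolding shift_prod_def by (cases "finite s") auto

lemma degree_shift_prod: "degree (shift_prod s) = card s"
  unfolding shift_prod_def by (cases "finite s") (auto simp: degree_prod_eq_sum_degree)

lemma shift_prod_insert:
  "finite s \<Longrightarrow> a \<notin> s \<Longrightarrow> shift_prod (insert a s) = [:a, 1:] * shift_prod s"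
  unfolding shift_prod_def by (rule prod.insert)

lemma poly_shift_prod_eq_0_iff:
  "finite s \<Longrightarrow> poly (shift_prod s) x = 0 \<longleftrightarrow> - x \<in> s"
  unfolding shift_prod_def poly_prod by (auto simp: prod_zero_iff add_eq_0_iff2 intro: bexI[of _ "- x"])

lemma shift_prod_split:
  "finite A \<Longrightarrow> s \<subseteq> A \<Longrightarrow> shift_prod A = shift_prod s * shift_prod (A - s)"
  unfolding shift_prod_def by (metis prod.subset_diff mult.commute)

lemma derivation_by_twisted:
  assumes "finite A" "s \<subseteq> A"
  shows "derivation_by (shift_prod A) (P * shift_prod s ^ d)
         = twisted_derivation A d s P * shift_prod s ^ d"
proof (cases d)
  case 0
  then show ?thesis by (simp add: derivation_by_def twisted_derivation_def)
next
  case (Suc n)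
  show ?thesis
    unfolding derivation_by_def twisted_derivation_def Suc pderiv_mult pderiv_power_Suc
    by (simp add: shift_prod_split[OF assms] algebra_simps)
qed

lemma derivation_by_iter_twisted:
  assumes "finite A" "s \<subseteq> A"
  shows "(derivation_by (shift_prod A) ^^ j) (P * shift_prod s ^ d)
         = (twisted_derivation A d s ^^ j) P * shift_prod s ^ d"
  by (induction j) (auto simp: derivation_by_twisted[OF assms])

lemma twisted_derivation_add:
  "twisted_derivation A d s (P + Q) = twisted_derivation A d s P + twisted_derivation A d s Q"
  by (simp add: twisted_derivation_def pderiv_add algebra_simps smult_add_right)

lemma twisted_derivation_smult:
  "twisted_derivation A d s (smult c P) = smult c (twisted_derivation A d s P)"
  by (simp add: twisted_derivation_def pderiv_smult smult_add_right)

lemma twisted_derivation_0 [simp]: "twisted_derivation A d s 0 = 0"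
  by (simp add: twisted_derivation_def)

lemma twisted_derivation_iter_0 [simp]: "(twisted_derivation A d s ^^ j) 0 = 0"
  by (induction j) auto

lemma twisted_derivation_iter_sum:
  "(twisted_derivation A d s ^^ j) (\<Sum>i\<in>I. smult (c i) (P i))
   = (\<Sum>i\<in>I. smult (c i) ((twisted_derivation A d s ^^ j) (P i)))"
proof -
  have add: "(twisted_derivation A d s ^^ j) (P + Q)
      = (twisted_derivation A d s ^^ j) P + (twisted_derivation A d s ^^ j) Q" for P Q
    by (induction j) (auto simp: twisted_derivation_add)
  have sm: "(twisted_derivation A d s ^^ j) (smult c P)
      = smult c ((twisted_derivation A d s ^^ j) P)" for c P
    by (induction j) (auto simp: twisted_derivation_smult)
  show ?thesis
    by (induction I rule: infinite_finite_induct) (auto simp: add sm)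
qed

lemma degree_twisted_derivation:
  assumes "finite A" "s \<subseteq> A"
  shows "degree (twisted_derivation A d s P) \<le> degree P + card A"
proof -
  have "degree (shift_prod A * pderiv P) \<le> card A + degree P"
    by (rule order_trans[OF degree_mult_le])
       (auto simp: degree_shift_prod intro: order_trans[OF degree_pderiv_le])
  moreover have "degree (shift_prod (A - s) * pderiv (shift_prod s)) \<le> card (A - s) + card s"
    by (rule order_trans[OF degree_mult_le])
       (auto simp: degree_shift_prod intro!: order_trans[OF degree_pderiv_le])
  moreover have "card (A - s) + card s = card A"
    using assms by (metis Diff_disjoint Diff_partition Int_commute card_Un_disjoint finite_Diff
        finite_subset Un_commute)
  ultimately have sum: "degree (shift_prod A * pderiv P) \<le> card A + degree P"
    "degree (shift_prod (A - s) * pderiv (shift_prod s)) \<le> card A" by auto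
  have "degree (smult (of_nat d) (shift_prod (A - s) * pderiv (shift_prod s)) * P) \<le> card A + degree P"
    using sum(2) by (intro order_trans[OF degree_mult_le] add_mono)
      (auto intro: order_trans[OF degree_smult_le])
  with sum(1) show ?thesis
    unfolding twisted_derivation_def by (intro degree_add_le) (auto simp: add.commute)
qed

lemma degree_twisted_derivation_iter:
  assumes "finite A" "s \<subseteq> A"
  shows "degree ((twisted_derivation A d s ^^ j) P) \<le> degree P + j * card A"
proof (induction j)
  case (Suc j)
  then show ?case
    using degree_twisted_derivation[OF assms, of d "(twisted_derivation A d s ^^ j) P"] by auto
qed auto

section \<open>Orders of vanishing under derivations, and the zero estimate\<close>

lemma power_dvd_derivation_by:
  assumes "[:- c, 1:] ^ e dvd f"
  shows "[:- c, 1:] ^ (e - 1) dvd derivation_by U f"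
proof (cases e)
  case (Suc n)
  from assms obtain g where f: "f = [:- c, 1:] ^ Suc n * g" unfolding Suc by (elim dvdE)
  have "derivation_by U f
      = [:- c, 1:] ^ n * (U * ([:- c, 1:] * pderiv g + smult (of_nat (Suc n)) g))"
    unfolding f derivation_by_def pderiv_mult pderiv_power_Suc
    by (simp add: pderiv_pCons algebra_simps)
  then show ?thesis unfolding Suc by simp
qed auto

lemma power_dvd_derivation_by_iter:
  assumes "[:- c, 1:] ^ e dvd f"
  shows "[:- c, 1:] ^ (e - j) dvd (derivation_by U ^^ j) f"
proof (induction j)
  case (Suc j)
  then show ?case using power_dvd_derivation_by[OF Suc, of U] by auto
qed (use assms in auto)

lemma linear_power_dvd_mult_cancel:
  fixes f g :: "'a::field poly"
  assumes "[:- c, 1:] ^ e dvd f * g" "poly g c \<noteq> 0"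
  shows "[:- c, 1:] ^ e dvd f"
proof (cases "f = 0")
  case False
  have "g \<noteq> 0" using assms(2) by auto
  with False assms(1) have "e \<le> order c (f * g)" by (simp add: order_divides)
  also have "\<dots> = order c f"
    using False \<open>g \<noteq> 0\<close> assms(2) by (simp add: order_mult order_0I)
  finally show ?thesis by (simp add: order_divides)
qed auto

lemma linear_power_dvd_imp_zero:
  fixes f :: "'a::field poly"
  assumes "[:- c, 1:] ^ e dvd f" "degree f < e"
  shows "f = 0"
  using dvd_imp_degree_le[OF assms(1)] assms(2) by (auto simp: degree_linear_power)

text \<open>Choose an operator of order less than \<open>card F\<close> with coefficients of small degree that kills all
  terms but one. Applied to the sum it leaves \<open>R * shift_prod s0 ^ d\<close> with \<open>R\<close> of small degree, and
  \<open>R = 0\<close> would give the operator too many independent solutions.\<close>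

lemma zero_estimate:
  fixes P :: "'a set \<Rightarrow> 'a::field poly"
  assumes p: "prime CHAR('a)" and A: "finite A" "card A \<le> k"
    and F: "F \<subseteq> Pow A" "card F \<le> S"
    and deg: "\<And>s. s \<in> F \<Longrightarrow> degree (P s) \<le> D"
    and indep: "\<And>C. (\<And>s. pderiv (C s) = 0) \<Longrightarrow>
        (\<Sum>s\<in>F. C s * (P s * shift_prod s ^ d)) = 0 \<Longrightarrow> \<forall>s\<in>F. C s * P s = 0"
    and c: "- c \<notin> A"
    and e: "(S + 1) * (D + k * S + 1) \<le> e"
    and dvd: "[:- c, 1:] ^ e dvd (\<Sum>s\<in>F. P s * shift_prod s ^ d)"
  shows "\<forall>s\<in>F. P s = 0"
proof (rule ccontr)
  assume "\<not> ?thesis"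
  then obtain s0 where s0: "s0 \<in> F" "P s0 \<noteq> 0" by auto
  have finF: "finite F" using F(1) A(1) by (meson finite_Pow_iff finite_subset)
  define T where "T = {s \<in> F. P s \<noteq> 0}"
  have T: "finite T" "T \<subseteq> F" "s0 \<in> T" using finF s0 by (auto simp: T_def)
  define n where "n = card T"
  have n: "n \<le> S" "n > 0"
    using T card_mono[OF finF T(2)] F(2) by (auto simp: n_def card_gt_0_iff)
  define W where "W = D + k * S"
  define E where "E = S * W + 1"
  let ?tw = "\<lambda>s j. (twisted_derivation A d s ^^ j) (P s)"
  have "(n - 1) * (E + W) < n * E"
  proof -
    have "(n - 1) * W \<le> S * W" using n by (intro mult_right_mono) auto
    then have "(n - 1) * E + (n - 1) * W < (n - 1) * E + E"
      unfolding E_def by (metis Suc_eq_plus1 add_less_cancel_left le_imp_less_Suc)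
    also have "\<dots> = n * E" using n by (cases n) auto
    finally show ?thesis by (simp add: algebra_simps)
  qed
  \<comment> \<open>Unknowns: the \<open>E\<close> coefficients of each of the \<open>n\<close>
    polynomials \<open>b j\<close>. Equations: the \<open>E + W\<close> coefficients of each
    \<open>R s\<close> below with \<open>s \<noteq> s0\<close>. There are more unknowns because
    \<open>(n - 1) * W < E\<close>.\<close>
  then have "card ((T - {s0}) \<times> {..<E + W}) < card ({..<n} \<times> {..<E})"
    using T by (simp add: card_cartesian_product n_def)
  from homogeneous_system_nontrivial[OF _ _ this,
      of "\<lambda>(j, t) (s, l). coeff (monom 1 t * ?tw s j) l"] T
  obtain g where g: "\<exists>j<n. \<exists>t<E. g (j, t) \<noteq> (0::'a)"
    and sys: "\<And>s l. s \<in> T \<Longrightarrow> s \<noteq> s0 \<Longrightarrow> l < E + W \<Longrightarrow>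
      (\<Sum>(j, t)\<in>{..<n} \<times> {..<E}. g (j, t) * coeff (monom 1 t * ?tw s j) l) = 0"
    by (fastforce simp: case_prod_unfold)
  define b where "b j = (\<Sum>t<E. monom (g (j, t)) t)" for j
  have coeff_b: "coeff (b j) t = (if t < E then g (j, t) else 0)" for j t
    by (simp add: b_def coeff_sum)
  have deg_b: "degree (b j) \<le> S * W" for j
    by (rule degree_le) (simp add: coeff_b E_def)
  have deg_tw: "degree (?tw s j) \<le> W" if "s \<in> F" "j < n" for s j
  proof -
    have "degree (?tw s j) \<le> degree (P s) + j * card A"
      using that F by (intro degree_twisted_derivation_iter A) auto
    also have "\<dots> \<le> D + S * k"
      using that n A deg by (intro add_mono mult_mono) auto
    finally show ?thesis by (simp add: W_def mult.commute)
  qed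
  define R where "R s = (\<Sum>j<n. b j * ?tw s j)" for s
  have deg_R: "degree (R s) < E + W" if "s \<in> F" for s
  proof -
    have "degree (R s) \<le> S * W + W"
      unfolding R_def using that deg_tw deg_b
      by (intro degree_sum_le order_trans[OF degree_mult_le] add_mono) auto
    then show ?thesis by (simp add: E_def)
  qed
  have R0: "R s = 0" if "s \<in> T" "s \<noteq> s0" for s
  proof (rule poly_eqI)
    fix l
    show "coeff (R s) l = coeff 0 l"
    proof (cases "l < E + W")
      case True
      have "R s = (\<Sum>j<n. \<Sum>t<E. smult (g (j, t)) (monom 1 t * ?tw s j))"
        unfolding R_def b_def sum_distrib_right
        by (intro sum.cong refl) (simp add: smult_monom flip: mult_smult_left)
      also have "coeff \<dots> l = (\<Sum>j<n. \<Sum>t<E. g (j, t) * coeff (monom 1 t * ?tw s j) l)"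
        by (simp add: coeff_sum)
      also have "\<dots> = 0"
        using sys[OF that True] by (simp add: sum.cartesian_product case_prod_unfold)
      finally show ?thesis by simp
    next
      case False
      then show ?thesis using deg_R[of s] that T by (auto intro!: coeff_eq_0)
    qed
  qed
  let ?D = "derivation_by (shift_prod A)"
  have L: "(\<Sum>j<n. b j * (?D ^^ j) (P s * shift_prod s ^ d)) = R s * shift_prod s ^ d"
    if "s \<in> F" for s
    using that F(1) A unfolding R_def sum_distrib_right
    by (intro sum.cong refl) (auto simp: derivation_by_iter_twisted)
  let ?Q = "\<Sum>s\<in>F. P s * shift_prod s ^ d"
  have Q: "?Q = (\<Sum>s\<in>T. P s * shift_prod s ^ d)"
    using finF by (intro sum.mono_neutral_right) (auto simp: T_def)
  \<comment> \<open>Fewer than \<open>n\<close> derivations cost fewer than \<open>n\<close> orders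
    of vanishing at \<open>c\<close>.\<close>
  have "[:- c, 1:] ^ (e - n) dvd (\<Sum>j<n. b j * (?D ^^ j) ?Q)"
    using power_dvd_derivation_by_iter[OF dvd]
    by (intro dvd_sum dvd_mult) (meson diff_le_mono2 le_imp_power_dvd dvd_trans lessThan_iff less_imp_le)
  also have "(\<Sum>j<n. b j * (?D ^^ j) ?Q) = (\<Sum>s\<in>T. R s * shift_prod s ^ d)"
    unfolding Q derivation_by_iter_sum sum_distrib_left
    using T L by (subst sum.swap) (auto intro!: sum.cong)
  also have "\<dots> = R s0 * shift_prod s0 ^ d"
    using T R0 by (subst sum.remove[of _ s0]) auto
  finally have dvd_R: "[:- c, 1:] ^ (e - n) dvd R s0 * shift_prod s0 ^ d" .
  have "s0 \<subseteq> A" using F(1) s0 by auto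
  then have "poly (shift_prod s0) c \<noteq> 0"
    using c A(1) finite_subset[of s0 A] by (auto simp: poly_shift_prod_eq_0_iff)
  then have "[:- c, 1:] ^ (e - n) dvd R s0"
    by (intro linear_power_dvd_mult_cancel[OF dvd_R]) simp
  moreover have "degree (R s0) < e - n"
    using deg_R[OF s0(1)] e n by (simp add: E_def W_def)
  ultimately have "R s0 = 0" by (rule linear_power_dvd_imp_zero)
  with R0 have R: "R s = 0" if "s \<in> T" for s using that by blast
  \<comment> \<open>The top coefficients of the operator may vanish, so its true order
    \<open>r\<close> is the largest index with \<open>b r \<noteq> 0\<close>.\<close>
  define J where "J = {j. j < n \<and> b j \<noteq> 0}"
  have "finite J" "J \<noteq> {}" using g coeff_b by (auto simp: J_def) (metis coeff_0)
  define r where "r = Max J"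
  have r: "r < n" "b r \<noteq> 0" using Max_in[OF \<open>finite J\<close> \<open>J \<noteq> {}\<close>] by (auto simp: r_def J_def)
  have b0: "b j = 0" if "j < n" "r < j" for j
  proof (rule ccontr)
    assume "b j \<noteq> 0"
    then have "j \<in> J" using that by (simp add: J_def)
    then show False using Max_ge[OF \<open>finite J\<close>] that by (simp add: r_def leD)
  qed
  have sol: "(\<Sum>j\<le>r. b j * (?D ^^ j) (P s * shift_prod s ^ d)) = 0" if "s \<in> T" for s
  proof -
    have "(\<Sum>j\<le>r. b j * (?D ^^ j) (P s * shift_prod s ^ d))
        = (\<Sum>j<n. b j * (?D ^^ j) (P s * shift_prod s ^ d))"
      using r b0 by (intro sum.mono_neutral_left) auto
    also have "\<dots> = 0" using L R that T by auto
    finally show ?thesis .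
  qed
  have "r < card T" using r(1) by (simp add: n_def)
  obtain C where C: "\<And>s. pderiv (C s) = 0" "\<exists>s\<in>T. C s \<noteq> 0"
    "(\<Sum>s\<in>T. C s * (P s * shift_prod s ^ d)) = 0"
    by (rule operator_solutions_dependent[where f = "\<lambda>s. P s * shift_prod s ^ d",
          OF p T(1) \<open>r < card T\<close> shift_prod_nonzero r(2) sol], assumption, rule that)
  have "(\<Sum>s\<in>F. C s * (P s * shift_prod s ^ d)) = (\<Sum>s\<in>T. C s * (P s * shift_prod s ^ d))"
    using finF by (intro sum.mono_neutral_right) (auto simp: T_def)
  with indep[OF C(1)] C(3) have "\<forall>s\<in>F. C s * P s = 0" by simp
  with C(2) show False by (auto simp: T_def)
qed

section \<open>Constants in characteristic \<open>p\<close> and independence over them\<close>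

lemma zero_pderiv_power_CHAR_dvd:
  fixes f :: "'a::field poly"
  assumes "prime CHAR('a)" "pderiv f = 0" "poly f c = 0"
  shows "[:- c, 1:] ^ CHAR('a) dvd f"
proof (cases "f = 0")
  case False
  define m where "m = order c f"
  obtain g where g: "f = [:- c, 1:] ^ m * g" "\<not> [:- c, 1:] dvd g"
    using order_decomp[OF False, of c] by (auto simp: m_def)
  have "m \<noteq> 0" using False assms(3) order_root[of f c] by (simp add: m_def)
  then obtain q where q: "m = Suc q" by (cases m) auto
  \<comment> \<open>After cancelling \<open>[:- c, 1:] ^ q\<close> and evaluating at
    \<open>c\<close>, what remains is \<open>m * g(c) = 0\<close>, so the order \<open>m\<close> is
    a multiple of the characteristic.\<close>
  have "0 = [:- c, 1:] ^ q * ([:- c, 1:] * pderiv g + smult (of_nat m) g)"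
    using assms(2) unfolding g(1) q pderiv_mult pderiv_power_Suc
    by (simp add: pderiv_pCons algebra_simps)
  then have eq: "[:- c, 1:] * pderiv g + smult (of_nat m) g = 0" by simp
  have "poly g c \<noteq> 0" using g(2) by (simp add: poly_eq_0_iff_dvd)
  moreover have "poly ([:- c, 1:] * pderiv g + smult (of_nat m) g) c = of_nat m * poly g c" by simp
  ultimately have "of_nat m = (0 :: 'a)" unfolding eq by simp
  then have "CHAR('a) dvd m" by (simp add: of_nat_eq_0_iff_char_dvd)
  then have "CHAR('a) \<le> m" using \<open>m \<noteq> 0\<close> by (simp add: dvd_imp_le)
  then show ?thesis unfolding g(1) by (simp add: le_imp_power_dvd dvd_mult2)
qed auto

lemma pderiv_linear_power_CHAR:
  "pderiv ([:c, 1:] ^ CHAR('a) :: 'a::field poly) = 0"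
  by (simp add: pderiv_power)

text \<open>Split a relation according to whether \<open>a \<in> s\<close>, as \<open>Q0 + (x + a) ^ d * Q1 = 0\<close>. Modulo
  \<open>(x + a) ^ p\<close> a constant is a scalar, so the zero estimate applies to \<open>Q0\<close>, and then, since
  \<open>p - d \<ge> d\<close>, to \<open>Q1\<close>; all coefficients turn out divisible by \<open>(x + a) ^ p\<close>.\<close>

lemma constants_independent:
  fixes P :: "'a set \<Rightarrow> 'a::field poly"
  assumes p: "prime CHAR('a)" "2 * d \<le> CHAR('a)" and "finite A"
    and "card A \<le> k" and "F \<subseteq> Pow A" "card F \<le> S"
    and "\<And>s. s \<in> F \<Longrightarrow> degree (P s) \<le> D"
    and d: "(S + 1) * (D + k * S + 1) \<le> d"
    and "\<And>s. pderiv (C s) = 0"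
    and "(\<Sum>s\<in>F. C s * (P s * shift_prod s ^ d)) = 0"
  shows "\<forall>s\<in>F. C s * P s = 0"
  using assms(3-7,9-10)
proof (induction A arbitrary: F P C rule: finite_induct)
  case empty
  then have "F = {} \<or> F = {{}}" by auto
  then show ?case using empty by (auto simp: shift_prod_def)
next
  case (insert a A)
  \<comment> \<open>The induction hypothesis for \<open>A\<close> supplies the independence that the
    zero estimate requires at the new point \<open>- a\<close>.\<close>
  have zero: "\<forall>s\<in>F. P s = 0"
    if F: "F \<subseteq> Pow A" "card F \<le> S" and deg: "\<And>s. s \<in> F \<Longrightarrow> degree (P s) \<le> D"
      and dvd: "[:a, 1:] ^ d dvd (\<Sum>s\<in>F. P s * shift_prod s ^ d)"
    for F and P :: "'a set \<Rightarrow> 'a poly"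
    using that(4) insert.hyps insert.prems(1) d
    by (intro zero_estimate[OF p(1) insert.hyps(1) _ F deg, where c = "- a" and e = d and k = k and d = d]
          insert.IH[OF _ F deg]) auto
  have finF: "finite F" using insert.prems(2) insert.hyps(1) by (meson finite_Pow_iff finite_insert finite_subset)
  define q where "q = CHAR('a)"
  have q: "d \<le> q" "d \<le> q - d" "q > 0" using p by (auto simp: q_def prime_gt_0_nat)
  define X where "X = [:a, 1:]"
  have X: "X \<noteq> 0" "degree X = 1" by (auto simp: X_def)
  define F0 where "F0 = {s\<in>F. a \<notin> s}"
  define F1 where "F1 = {s. a \<notin> s \<and> insert a s \<in> F}"
  have F0: "F0 \<subseteq> Pow A" "card F0 \<le> S" "finite F0" "F0 \<subseteq> F"
    using insert.prems(2,3) card_mono[OF finF, of F0] finF by (auto simp: F0_def)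
  have F1_img: "insert a ` F1 = F - F0"
  proof (intro Set.set_eqI iffI)
    fix s assume "s \<in> F - F0"
    then have "insert a (s - {a}) = s" "s - {a} \<in> F1" by (auto simp: F0_def F1_def insert_absorb)
    then show "s \<in> insert a ` F1" by (metis imageI)
  qed (auto simp: F0_def F1_def)
  have inj: "inj_on (insert a) F1" by (auto simp: F1_def inj_on_def insert_ident)
  have F1: "F1 \<subseteq> Pow A" "card F1 \<le> S" "finite F1"
  proof -
    have *: "finite (insert a ` F1)" using finF by (simp add: F1_img)
    then show "finite F1" using inj by (rule finite_imageD)
    have "card F1 = card (F - F0)" using card_image[OF inj] F1_img by simp
    also have "\<dots> \<le> card F" using finF by (intro card_mono) auto
    finally show "card F1 \<le> S" using insert.prems(3) by simp
    show "F1 \<subseteq> Pow A" using insert.prems(2) by (auto simp: F1_def)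
  qed
  have sum_split: "(\<Sum>s\<in>F. C s * (P s * shift_prod s ^ d))
      = (\<Sum>s\<in>F0. C s * (P s * shift_prod s ^ d))
        + X ^ d * (\<Sum>s\<in>F1. C (insert a s) * (P (insert a s) * shift_prod s ^ d))" for C
  proof -
    have "(\<Sum>s\<in>F. C s * (P s * shift_prod s ^ d)) = (\<Sum>s\<in>F0. C s * (P s * shift_prod s ^ d))
        + (\<Sum>s\<in>insert a ` F1. C s * (P s * shift_prod s ^ d))"
      using sum.subset_diff[OF F0(4) finF] F1_img by (simp add: add.commute)
    also have "(\<Sum>s\<in>insert a ` F1. C s * (P s * shift_prod s ^ d))
        = (\<Sum>s\<in>F1. C (insert a s) * (P (insert a s) * shift_prod (insert a s) ^ d))"
      using inj by (simp add: sum.reindex)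
    also have "\<dots> = (\<Sum>s\<in>F1. X ^ d * (C (insert a s) * (P (insert a s) * shift_prod s ^ d)))"
    proof (intro sum.cong refl)
      fix s assume "s \<in> F1"
      then have "finite s" "a \<notin> s"
        using F1(1) insert.hyps(1) by (auto simp: F1_def intro: finite_subset)
      then have "shift_prod (insert a s) = X * shift_prod s"
        unfolding X_def by (rule shift_prod_insert)
      then show "C (insert a s) * (P (insert a s) * shift_prod (insert a s) ^ d)
          = X ^ d * (C (insert a s) * (P (insert a s) * shift_prod s ^ d))"
        by (simp add: power_mult_distrib algebra_simps)
    qed
    finally show ?thesis by (simp add: sum_distrib_left)
  qed
  have const: "\<exists>R. C = [:poly C (- a):] + X ^ q * R" if "pderiv C = 0" for C :: "'a poly"
  proof -
    have "X ^ q dvd C - [:poly C (- a):]"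
      using zero_pderiv_power_CHAR_dvd[OF p(1), of "C - [:poly C (- a):]" "- a"] that
      by (simp add: pderiv_diff X_def q_def)
    then obtain R where "C - [:poly C (- a):] = X ^ q * R" by (elim dvdE)
    then show ?thesis by (metis add.commute diff_add_cancel)
  qed
  \<comment> \<open>As \<open>d \<le> q\<close>, replacing each \<open>C s\<close> by the scalar
    \<open>poly (C s) (- a)\<close> does not affect divisibility by \<open>X ^ d\<close>; the zero
    estimate then kills these scalars.\<close>
  have vanish: "X ^ q dvd C s"
    if H: "H \<subseteq> Pow A" "card H \<le> S" "finite H" and deg: "\<And>s. s \<in> H \<Longrightarrow> degree (P s) \<le> D"
      and C: "\<And>s. pderiv (C s) = 0" "\<And>s. P s = 0 \<Longrightarrow> C s = 0"
      and dvd: "X ^ d dvd (\<Sum>s\<in>H. C s * (P s * shift_prod s ^ d))" and s: "s \<in> H"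
    for H s and P C :: "'a set \<Rightarrow> 'a poly"
  proof -
    from const[OF C(1)] obtain R where R: "\<And>s. C s = [:poly (C s) (- a):] + X ^ q * R s" by metis
    have eq: "(\<Sum>s\<in>H. C s * (P s * shift_prod s ^ d))
        = (\<Sum>s\<in>H. smult (poly (C s) (- a)) (P s) * shift_prod s ^ d)
          + X ^ q * (\<Sum>s\<in>H. R s * (P s * shift_prod s ^ d))"
      unfolding sum_distrib_left sum.distrib[symmetric]
      by (intro sum.cong refl, subst R) (simp add: algebra_simps)
    have small: "X ^ d dvd X ^ q * Y" for Y using q by (simp add: le_imp_power_dvd dvd_mult2)
    have "X ^ d dvd (\<Sum>s\<in>H. smult (poly (C s) (- a)) (P s) * shift_prod s ^ d)"
      using dvd unfolding eq dvd_add_left_iff[OF small] .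
    with zero[OF H(1,2), of "\<lambda>s. smult (poly (C s) (- a)) (P s)"] deg s
    have "smult (poly (C s) (- a)) (P s) = 0"
      unfolding X_def by (auto intro: order_trans[OF degree_smult_le])
    then have "poly (C s) (- a) = 0" using C(2)[of s] by auto
    then have "C s = X ^ q * R s" by (subst R) simp
    then show ?thesis by simp
  qed
  \<comment> \<open>Descent on the total degree: all \<open>C s\<close> are divisible by
    \<open>X ^ q\<close>, and the quotients satisfy the same hypotheses.\<close>
  have main: "\<forall>s\<in>F. C s = 0"
    if "\<And>s. pderiv (C s) = 0" "\<And>s. P s = 0 \<Longrightarrow> C s = 0"
      and "(\<Sum>s\<in>F. C s * (P s * shift_prod s ^ d)) = 0" for C
    using that
  proof (induction "\<Sum>s\<in>F. degree (C s)" arbitrary: C rule: less_induct)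
    case less
    note C = less.prems
    define Q0 where "Q0 = (\<Sum>s\<in>F0. C s * (P s * shift_prod s ^ d))"
    define Q1 where "Q1 = (\<Sum>s\<in>F1. C (insert a s) * (P (insert a s) * shift_prod s ^ d))"
    have "Q0 + X ^ d * Q1 = 0" using sum_split C(3) by (simp add: Q0_def Q1_def)
    then have Q: "Q0 = - (X ^ d * Q1)" by (simp add: eq_neg_iff_add_eq_0)
    then have "X ^ d dvd Q0" by simp
    then have v0: "X ^ q dvd C s" if "s \<in> F0" for s
      using that F0 C insert.prems(4) by (intro vanish[of F0 P C]) (auto simp: Q0_def)
    \<comment> \<open>Every coefficient in \<open>Q0\<close> carries \<open>X ^ q\<close>, of which
      the factor in front of \<open>Q1\<close> absorbs only \<open>X ^ d\<close>.\<close>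
    have "X ^ q dvd Q0" unfolding Q0_def by (intro dvd_sum dvd_mult2 v0)
    then have "X ^ q dvd X ^ d * Q1" unfolding Q by simp
    then have "X ^ d * X ^ (q - d) dvd X ^ d * Q1" using q by (simp flip: power_add)
    then have "X ^ (q - d) dvd Q1" using X by simp
    then have "X ^ d dvd Q1" using q(2) by (meson dvd_trans le_imp_power_dvd)
    then have v1: "X ^ q dvd C (insert a s)" if "s \<in> F1" for s
      using that F1 C insert.prems(4)
      by (intro vanish[of F1 "\<lambda>s. P (insert a s)" "\<lambda>s. C (insert a s)"]) (auto simp: F1_def Q1_def)
    have v: "X ^ q dvd C s" if "s \<in> F" for s
    proof (cases "s \<in> F0")
      case False
      then have "s \<in> insert a ` F1" using that F1_img by auto
      then show ?thesis using v1 by auto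
    qed (use v0 in auto)
    define B where "B s = (if s \<in> F then C s div X ^ q else 0)" for s
    have CB: "C s = X ^ q * B s" if "s \<in> F" for s using v[OF that] that by (simp add: B_def)
    have dX: "pderiv (X ^ q) = 0" unfolding X_def q_def by (rule pderiv_linear_power_CHAR)
    have B1: "pderiv (B s) = 0" for s
    proof (cases "s \<in> F")
      case True
      have "0 = X ^ q * pderiv (B s)"
        using C(1)[of s] dX unfolding CB[OF True] pderiv_mult by simp
      then show ?thesis using X by simp
    qed (simp add: B_def)
    have B2: "B s = 0" if "P s = 0" for s using C(2)[OF that] by (simp add: B_def)
    have "X ^ q * (\<Sum>s\<in>F. B s * (P s * shift_prod s ^ d)) = (\<Sum>s\<in>F. C s * (P s * shift_prod s ^ d))"
      unfolding sum_distrib_left by (intro sum.cong refl) (simp add: CB)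
    then have B3: "(\<Sum>s\<in>F. B s * (P s * shift_prod s ^ d)) = 0" using C(3) X by auto
    show ?case
    proof (cases "\<forall>s\<in>F. C s = 0")
      case False
      then obtain t where t: "t \<in> F" "C t \<noteq> 0" by auto
      have deg: "degree (C s) = q + degree (B s)" if "s \<in> F" "C s \<noteq> 0" for s
        using that X CB[of s] by (auto simp: degree_mult_eq degree_power_eq)
      have "(\<Sum>s\<in>F. degree (B s)) < (\<Sum>s\<in>F. degree (C s))"
      proof (rule sum_strict_mono_ex1[OF finF])
        show "\<forall>s\<in>F. degree (B s) \<le> degree (C s)"
        proof
          fix s assume "s \<in> F"
          then show "degree (B s) \<le> degree (C s)" using deg[of s] CB[of s] X by (cases "C s = 0") auto
        qed
        show "\<exists>s\<in>F. degree (B s) < degree (C s)" using t deg[OF t] q by (intro bexI[of _ t]) auto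
      qed
      from less.hyps[OF this B1 B2 B3] show ?thesis using CB by auto
    qed simp
  qed
  \<comment> \<open>A coefficient standing at a zero \<open>P s\<close> is arbitrary, so it is set
    to zero before the descent.\<close>
  define C' where "C' s = (if P s = 0 then 0 else C s)" for s
  have "\<forall>s\<in>F. C' s = 0"
  proof (rule main)
    have "(\<Sum>s\<in>F. C' s * (P s * shift_prod s ^ d)) = (\<Sum>s\<in>F. C s * (P s * shift_prod s ^ d))"
      by (intro sum.cong) (auto simp: C'_def)
    then show "(\<Sum>s\<in>F. C' s * (P s * shift_prod s ^ d)) = 0" using insert.prems by simp
  qed (use insert.prems in \<open>auto simp: C'_def\<close>)
  then show ?case by (auto simp: C'_def split: if_splits)
qed

section \<open>Stepanov's bound\<close>

text \<open>As long as a positive order of vanishing is below the characteristic, a derivation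
  lowers it by exactly one: the factor brought down is nonzero in the field, and so is
  \<open>U\<close> at \<open>b\<close>. An order \<open>m < M\<close> would thus make the
  \<open>m\<close>-th iterate nonzero at \<open>b\<close>.\<close>

lemma linear_power_dvd_of_derivations:
  fixes f :: "'a::field poly"
  assumes "f \<noteq> 0" "poly U b \<noteq> 0" "M \<le> CHAR('a)"
    and zero: "\<And>j. j < M \<Longrightarrow> poly ((derivation_by U ^^ j) f) b = 0"
  shows "[:- b, 1:] ^ M dvd f"
proof (rule ccontr)
  assume "\<not> ?thesis"
  then have m: "order b f < M" using assms(1) by (simp add: order_divides)
  define m where "m = order b f"
  have "\<exists>g. (derivation_by U ^^ i) f = [:- b, 1:] ^ (m - i) * g \<and> poly g b \<noteq> 0" if "i \<le> m" for i
    using that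
  proof (induction i)
    case 0
    then show ?case
      using order_decomp[OF assms(1), of b] by (auto simp: m_def poly_eq_0_iff_dvd)
  next
    case (Suc i)
    then obtain g where g: "(derivation_by U ^^ i) f = [:- b, 1:] ^ (m - i) * g" "poly g b \<noteq> 0"
      by auto
    obtain q where q: "m - i = Suc q" "m - Suc i = q" using Suc.prems by (cases "m - i") auto
    let ?h = "U * ([:- b, 1:] * pderiv g + smult (of_nat (Suc q)) g)"
    have "(derivation_by U ^^ Suc i) f = [:- b, 1:] ^ q * ?h"
      using g(1) unfolding q
      by (simp add: derivation_by_def pderiv_mult pderiv_power_Suc pderiv_pCons algebra_simps del: power_Suc)
         (simp add: algebra_simps)
    moreover have "of_nat (Suc q) \<noteq> (0 :: 'a)"
      using q m assms(3) unfolding of_nat_eq_0_iff_char_dvd m_def by (auto dest!: dvd_imp_le)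
    then have "poly ?h b \<noteq> 0" using g(2) assms(2) by (simp del: of_nat_Suc)
    ultimately show ?case unfolding q by blast
  qed
  from this[of m] zero[of m] m show False by (auto simp: m_def)
qed

lemma card_mult_le_degree:
  fixes f :: "'a::field poly"
  assumes "finite N" "f \<noteq> 0" "\<And>b. b \<in> N \<Longrightarrow> [:- b, 1:] ^ M dvd f"
  shows "M * card N \<le> degree f"
proof -
  have order: "M \<le> order b f" if "b \<in> N" for b
    using assms(2) assms(3)[OF that] by (simp add: order_divides)
  have "M * card N = (\<Sum>b\<in>N. M)" by simp
  also have "\<dots> \<le> (\<Sum>b\<in>N. count (proots f) b)"
    using order assms(2) by (intro sum_mono) simp
  also have "\<dots> \<le> (\<Sum>b\<in>N \<union> set_mset (proots f). count (proots f) b)"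
    using assms(1) by (intro sum_mono2) auto
  also have "\<dots> = size (proots f)"
    unfolding size_multiset_overloaded_eq using assms(1)
    by (intro sum.mono_neutral_right) (auto simp: not_in_iff simp del: set_count_proots)
  also have "\<dots> \<le> degree f" by (rule size_proots_le)
  finally show ?thesis .
qed

text \<open>At a point of \<open>N\<close> every \<open>shift_prod s ^ d\<close> is 1, so the
  \<open>j\<close>-th iterated derivation of the auxiliary polynomial takes there the value of a
  polynomial \<open>R j\<close> of small degree. Requiring \<open>R j = 0\<close> for all
  \<open>j < M\<close> is a linear system of \<open>M * (D + M * k)\<close> equations in the
  \<open>S * D\<close> coefficients of the \<open>P s\<close>.\<close>

lemma stepanov_bound:
  fixes A N :: "'a::field set"
  assumes p: "prime CHAR('a)" "2 * d \<le> CHAR('a)" and A: "finite A" "card A \<le> k"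
    and F: "F \<subseteq> Pow A" "card F = S" and h: "\<And>s. s \<in> F \<Longrightarrow> card s \<le> h"
    and M: "M * (D + M * k) < S * D" "M \<le> CHAR('a)"
    and d: "(S + 1) * (D + k * S) \<le> d"
    and N: "finite N" "\<And>a b. a \<in> A \<Longrightarrow> b \<in> N \<Longrightarrow> (a + b) ^ d = 1"
  shows "M * card N \<le> h * d + D"
proof -
  have finF: "finite F" using F(1) A(1) by (meson finite_Pow_iff finite_subset)
  have "D > 0" using M(1) by (cases D) auto
  then have "d > 0" using d by (cases d) auto
  let ?tw = "\<lambda>s j. twisted_derivation A d s ^^ j"
  have "card ({..<M} \<times> {..<D + M * k}) < card (F \<times> {..<D})"
    using M(1) F(2) by (simp add: card_cartesian_product)
  from homogeneous_system_nontrivial[OF _ _ this,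
      of "\<lambda>(s, t) (j, l). coeff (?tw s j (monom 1 t)) l"] finF
  obtain g where g: "\<exists>s\<in>F. \<exists>t<D. g (s, t) \<noteq> (0::'a)"
    and sys: "\<And>j l. j < M \<Longrightarrow> l < D + M * k \<Longrightarrow>
      (\<Sum>(s, t)\<in>F \<times> {..<D}. g (s, t) * coeff (?tw s j (monom 1 t)) l) = 0"
    by (fastforce simp: case_prod_unfold)
  define P where "P s = (\<Sum>t<D. smult (g (s, t)) (monom 1 t))" for s
  have coeff_P: "coeff (P s) t = (if t < D then g (s, t) else 0)" for s t
    by (simp add: P_def coeff_sum if_distrib cong: if_cong)
  have deg_P: "degree (P s) \<le> D - 1" for s
    using \<open>D > 0\<close> by (intro degree_le) (auto simp: coeff_P)
  define R where "R j = (\<Sum>s\<in>F. ?tw s j (P s))" for j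
  have R: "R j = 0" if "j < M" for j
  proof (rule poly_eqI)
    fix l
    show "coeff (R j) l = coeff 0 l"
    proof (cases "l < D + M * k")
      case True
      have "coeff (R j) l = (\<Sum>s\<in>F. \<Sum>t<D. g (s, t) * coeff (?tw s j (monom 1 t)) l)"
        by (simp add: R_def P_def twisted_derivation_iter_sum coeff_sum)
      also have "\<dots> = 0"
        using sys[OF that True] by (simp add: sum.cartesian_product case_prod_unfold)
      finally show ?thesis by simp
    next
      case False
      have "degree (?tw s j (P s)) \<le> (D - 1) + M * k" if "s \<in> F" for s
      proof -
        have "degree (?tw s j (P s)) \<le> degree (P s) + j * card A"
          using that F(1) by (intro degree_twisted_derivation_iter A) auto
        also have "\<dots> \<le> (D - 1) + M * k"
          using \<open>j < M\<close> A deg_P by (intro add_mono mult_mono) auto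
        finally show ?thesis .
      qed
      then have "degree (R j) \<le> (D - 1) + M * k" unfolding R_def by (intro degree_sum_le finF)
      then show ?thesis using False \<open>D > 0\<close> by (auto intro!: coeff_eq_0)
    qed
  qed
  define f where "f = (\<Sum>s\<in>F. P s * shift_prod s ^ d)"
  \<comment> \<open>Independence over the constants, with all constants equal to 1.\<close>
  have "f \<noteq> 0"
  proof
    assume "f = 0"
    then have "\<forall>s\<in>F. 1 * P s = 0"
      using p A F d deg_P \<open>D > 0\<close> unfolding f_def
      by (intro constants_independent[where A = A and k = k and S = S and D = "D - 1" and d = d
            and C = "\<lambda>_. 1"]) (auto simp: algebra_simps)
    then show False using g coeff_P by (metis coeff_0 mult_1)
  qed
  have "degree f \<le> h * d + D"
    unfolding f_def
  proof (intro degree_sum_le finF)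
    fix s assume s: "s \<in> F"
    have "degree (P s * shift_prod s ^ d) \<le> degree (P s) + d * card s"
      using degree_mult_le[of "P s" "shift_prod s ^ d"]
      by (simp add: degree_power_eq degree_shift_prod mult.commute)
    also have "\<dots> \<le> D + d * h" using deg_P[of s] h[OF s] by (intro add_mono mult_mono) auto
    finally show "degree (P s * shift_prod s ^ d) \<le> h * d + D" by (simp add: algebra_simps)
  qed
  moreover have "[:- b, 1:] ^ M dvd f" if b: "b \<in> N" for b
  proof (rule linear_power_dvd_of_derivations[where U = "shift_prod A"])
    show "f \<noteq> 0" "M \<le> CHAR('a)" by fact+
    have one: "poly (shift_prod s ^ d) b = 1" if "s \<in> F" for s
    proof -
      have "poly (shift_prod s ^ d) b = (\<Prod>a\<in>s. (a + b) ^ d)"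
        by (simp add: shift_prod_def poly_prod poly_power prod_power_distrib)
      also have "\<dots> = 1" using that F(1) N(2) b by (intro prod.neutral) auto
      finally show ?thesis .
    qed
    show "poly (shift_prod A) b \<noteq> 0"
    proof
      assume "poly (shift_prod A) b = 0"
      then have "- b \<in> A" using A(1) by (simp add: poly_shift_prod_eq_0_iff)
      from N(2)[OF this b] show False using \<open>d > 0\<close> by (simp add: zero_power)
    qed
    fix j assume j: "j < M"
    have "(derivation_by (shift_prod A) ^^ j) f = (\<Sum>s\<in>F. ?tw s j (P s) * shift_prod s ^ d)"
      unfolding f_def derivation_by_iter_sum
      using F(1) A(1) by (intro sum.cong refl) (auto simp: derivation_by_iter_twisted)
    also have "poly \<dots> b = poly (R j) b"
      using one by (simp add: R_def poly_sum)
    finally show "poly ((derivation_by (shift_prod A) ^^ j) f) b = 0" using R[OF j] by simp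
  qed
  then have "M * card N \<le> degree f" using \<open>f \<noteq> 0\<close> N(1) by (intro card_mult_le_degree)
  ultimately show ?thesis by simp
qed

section \<open>The Hanson--Petridis polynomial\<close>

text \<open>There are \<open>card A - 1\<close> equations in \<open>card A\<close> unknowns. If the
  top moment vanished too, the weights would annihilate all polynomials of degree below
  \<open>card A\<close>, among them one that is nonzero at a single point of \<open>A\<close>,
  chosen with nonzero weight.\<close>

lemma divided_difference_weights:
  fixes A :: "'a::field set"
  assumes "finite A" "A \<noteq> {}"
  obtains c where "\<And>j. j < card A - 1 \<Longrightarrow> (\<Sum>a\<in>A. c a * a ^ j) = 0"
    "(\<Sum>a\<in>A. c a * a ^ (card A - 1)) = 1"
proof -
  have "card {..<card A - 1} < card A" using assms by (simp add: card_gt_0_iff)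
  from homogeneous_system_nontrivial[OF _ assms(1) this, of "\<lambda>a j. a ^ j"]
  obtain g where g: "\<exists>a\<in>A. g a \<noteq> 0" "\<And>j. j < card A - 1 \<Longrightarrow> (\<Sum>a\<in>A. g a * a ^ j) = 0"
    by auto
  define v where "v = (\<Sum>a\<in>A. g a * a ^ (card A - 1))"
  have "v \<noteq> 0"
  proof
    assume v: "v = 0"
    have zero: "(\<Sum>a\<in>A. g a * a ^ j) = 0" if "j \<le> card A - 1" for j
      using g(2)[of j] v that by (cases "j = card A - 1") (auto simp: v_def)
    obtain x where x: "x \<in> A" "g x \<noteq> 0" using g(1) by auto
    define q where "q = (\<Prod>a\<in>A - {x}. [:- a, 1:])"
    have deg: "degree q = card A - 1"
      using x assms(1) by (simp add: q_def degree_prod_eq_sum_degree)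
    have "(\<Sum>a\<in>A. g a * poly q a) = (\<Sum>i\<le>degree q. coeff q i * (\<Sum>a\<in>A. g a * a ^ i))"
      unfolding poly_altdef sum_distrib_left by (subst sum.swap) (simp add: algebra_simps)
    also have "\<dots> = 0" using zero by (simp add: deg)
    also have "(\<Sum>a\<in>A. g a * poly q a) = (\<Sum>a\<in>{x}. g a * poly q a)"
      using x assms(1) by (intro sum.mono_neutral_right) (auto simp: q_def poly_prod)
    finally have "poly q x = 0" using x by simp
    then show False using assms(1) by (auto simp: q_def poly_prod)
  qed
  then show thesis
    using g(2) by (intro that[of "\<lambda>a. g a / v"]) (simp_all add: v_def flip: sum_divide_distrib)
qed

text \<open>In the binomial expansion only the moment of exponent \<open>n\<close> survives.\<close>

lemma divided_difference_shifted_power: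
  fixes A :: "'a::field set"
  assumes "\<And>j. j < n \<Longrightarrow> (\<Sum>a\<in>A. c a * a ^ j) = 0" "(\<Sum>a\<in>A. c a * a ^ n) = 1" "m \<le> n"
  shows "(\<Sum>a\<in>A. c a * (a + b) ^ m) = (if m = n then 1 else 0)"
proof -
  have "(\<Sum>a\<in>A. c a * (a + b) ^ m)
      = (\<Sum>i\<le>m. of_nat (m choose i) * b ^ (m - i) * (\<Sum>a\<in>A. c a * a ^ i))"
    unfolding binomial_ring sum_distrib_left by (subst sum.swap) (simp add: algebra_simps)
  also have "\<dots> = (\<Sum>i\<le>m. if i = n then 1 else 0)"
    using assms by (intro sum.cong) auto
  also have "\<dots> = (if m = n then 1 else 0)" using assms(3) by simp
  finally show ?thesis .
qed

section \<open>Derivatives and coefficients of sums of shifted powers\<close>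

lemma pderiv_iter_linear_power:
  fixes a :: "'a::field"
  assumes "j \<le> n"
  shows "(pderiv ^^ j) ([:a, 1:] ^ n) = smult (\<Prod>i<j. of_nat (n - i)) ([:a, 1:] ^ (n - j))"
  using assms
proof (induction j)
  case (Suc j)
  then obtain q where q: "n - j = Suc q" "n - Suc j = q" by (cases "n - j") auto
  show ?case
    using Suc q(2) by (simp add: q(1) pderiv_smult pderiv_power_Suc pderiv_pCons del: power_Suc of_nat_Suc of_nat_diff)
qed simp

lemma derivation_by_1: "derivation_by 1 = pderiv"
  by (simp add: fun_eq_iff derivation_by_def)

lemma pderiv_iter_sum_smult:
  fixes f :: "'b \<Rightarrow> 'a::idom poly"
  shows "(pderiv ^^ j) (\<Sum>i\<in>I. smult (c i) (f i)) = (\<Sum>i\<in>I. smult (c i) ((pderiv ^^ j) (f i)))"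
proof -
  have "(pderiv ^^ j) (smult k g) = smult k ((pderiv ^^ j) g)" for k :: 'a and g
    by (induction j) (auto simp: pderiv_smult)
  then show ?thesis
    using derivation_by_iter_sum[where U = 1 and j = j and f = "\<lambda>i. smult (c i) (f i)" and I = I]
    by (simp add: derivation_by_1)
qed

lemma coeff_shifted_power_sum:
  fixes A :: "'a::field set"
  shows "coeff (\<Sum>a\<in>A. smult (c a) ([:a, 1:] ^ N)) i
    = of_nat (N choose i) * (\<Sum>a\<in>A. c a * a ^ (N - i))"
proof -
  have "coeff ([:a, 1:] ^ N) i = of_nat (N choose i) * a ^ (N - i)" for a :: 'a
  proof (cases "i \<le> N")
    case False
    then have "degree ([:a, 1:] ^ N) < i" by (simp add: degree_linear_power)
    then show ?thesis using False by (simp add: coeff_eq_0 binomial_eq_0)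
  qed (simp add: coeff_linear_poly_power)
  then show ?thesis by (simp add: coeff_sum sum_distrib_left algebra_simps)
qed

lemma of_nat_binomial_neq_0:
  assumes "prime CHAR('a::field)" "n < CHAR('a)" "k \<le> n"
  shows "of_nat (n choose k) \<noteq> (0 :: 'a)"
proof
  assume "of_nat (n choose k) = (0 :: 'a)"
  then have "CHAR('a) dvd fact n"
    using binomial_fact_lemma[OF assms(3)] by (metis dvd_mult of_nat_eq_0_iff_char_dvd)
  then show False using assms by (simp add: prime_dvd_fact_iff)
qed

text \<open>At \<open>b\<close> in \<open>B\<close> the relation \<open>(a + b) ^ d = 1\<close>
  turns the \<open>j\<close>-th derivative, up to a factor, into the divided difference of
  \<open>(x + b) ^ (n - 1 - j)\<close>, which is 1 for \<open>j = 0\<close> and 0 for other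
  \<open>j < n\<close>. After subtracting 1, the polynomial vanishes to order \<open>n\<close> on
  \<open>B\<close>, while its degree is \<open>d\<close>. In the case of equality these are all its
  roots, which determines it up to its leading coefficient.\<close>

theorem hanson_petridis:
  fixes A B :: "'a::field set"
  assumes p: "prime CHAR('a)" and A: "finite A" "A \<noteq> {}" and B: "finite B"
    and d: "0 < d" "d + card A \<le> CHAR('a)"
    and sums: "\<And>a b. a \<in> A \<Longrightarrow> b \<in> B \<Longrightarrow> (a + b) ^ d = 1"
  defines "n \<equiv> card A"
  obtains c where "\<And>j. j < n - 1 \<Longrightarrow> (\<Sum>a\<in>A. c a * a ^ j) = 0" "(\<Sum>a\<in>A. c a * a ^ (n - 1)) = 1"
    "n * card B \<le> d"
    "n * card B = d \<Longrightarrow> (\<Sum>a\<in>A. smult (c a) ([:a, 1:] ^ (d + n - 1))) - 1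
       = smult (of_nat ((d + n - 1) choose d)) (\<Prod>b\<in>B. [:- b, 1:] ^ n)"
proof -
  obtain c where c: "\<And>j. j < n - 1 \<Longrightarrow> (\<Sum>a\<in>A. c a * a ^ j) = 0"
    "(\<Sum>a\<in>A. c a * a ^ (n - 1)) = 1"
    using divided_difference_weights[OF A] unfolding n_def by blast
  have n: "n > 0" using A by (simp add: n_def card_gt_0_iff)
  define N where "N = d + n - 1"
  define K where "K = (of_nat (N choose d) :: 'a)"
  \<comment> \<open>The bound \<open>d + card A \<le> CHAR('a)\<close> keeps \<open>N\<close> below
    the characteristic, hence the leading coefficient nonzero.\<close>
  have K: "K \<noteq> 0"
    unfolding K_def N_def using p d n by (intro of_nat_binomial_neq_0) (auto simp: n_def)
  define f where "f = (\<Sum>a\<in>A. smult (c a) ([:a, 1:] ^ N)) - 1"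
  have coeff_f: "coeff f i = of_nat (N choose i) * (\<Sum>a\<in>A. c a * a ^ (N - i))" if "i > 0" for i
    unfolding f_def using that by (simp add: coeff_shifted_power_sum coeff_1)
  have coeff_d: "coeff f d = K"
    using coeff_f[OF d(1)] c(2) n by (simp add: K_def N_def)
  have "f \<noteq> 0" using coeff_d K by auto
  have deg: "degree f \<le> d"
  proof (rule degree_le, intro allI impI)
    fix i assume i: "d < i"
    show "coeff f i = 0"
    proof (cases "i \<le> N")
      case True
      then have "N - i < n - 1" using i by (simp add: N_def)
      then show ?thesis using coeff_f[of i] c(1)[of "N - i"] i by simp
    qed (use coeff_f[of i] i in \<open>simp add: binomial_eq_0\<close>)
  qed
  have dvd: "[:- b, 1:] ^ n dvd f" if b: "b \<in> B" for b
  proof (rule linear_power_dvd_of_derivations[where U = 1])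
    show "f \<noteq> 0" "n \<le> CHAR('a)" using \<open>f \<noteq> 0\<close> d by (auto simp: n_def)
    fix j assume j: "j < n"
    define k where "k = (\<Prod>i<j. of_nat (N - i) :: 'a)"
    have "(pderiv ^^ j) (\<Sum>a\<in>A. smult (c a) ([:a, 1:] ^ N))
        = (\<Sum>a\<in>A. smult (c a) (smult k ([:a, 1:] ^ (N - j))))"
      unfolding pderiv_iter_sum_smult k_def using j d(1)
      by (subst pderiv_iter_linear_power) (auto simp: N_def)
    also have "poly \<dots> b = k * (\<Sum>a\<in>A. c a * (a + b) ^ (N - j))"
      by (simp add: poly_sum poly_power sum_distrib_left algebra_simps)
    also have "(\<Sum>a\<in>A. c a * (a + b) ^ (N - j)) = (\<Sum>a\<in>A. c a * (a + b) ^ (n - 1 - j))"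
    proof (intro sum.cong refl)
      fix a assume a: "a \<in> A"
      have "N - j = d + (n - 1 - j)" using j n by (simp add: N_def)
      then show "c a * (a + b) ^ (N - j) = c a * (a + b) ^ (n - 1 - j)"
        using sums[OF a b] by (simp add: power_add)
    qed
    also have "\<dots> = (if j = 0 then 1 else 0)"
      using divided_difference_shifted_power[OF c, of "n - 1 - j" b] j by auto
    finally have *: "poly ((pderiv ^^ j) (\<Sum>a\<in>A. smult (c a) ([:a, 1:] ^ N))) b
        = k * (if j = 0 then 1 else 0)" .
    have "(pderiv ^^ j) f = (pderiv ^^ j) (\<Sum>a\<in>A. smult (c a) ([:a, 1:] ^ N)) - (if j = 0 then 1 else 0)"
      unfolding f_def by (induction j) (auto simp: pderiv_diff)
    with * show "poly ((derivation_by 1 ^^ j) f) b = 0"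
      by (simp add: derivation_by_1 k_def)
  qed auto
  have "n * card B \<le> d"
    using card_mult_le_degree[OF B \<open>f \<noteq> 0\<close> dvd] deg by simp
  moreover have "f = smult K (\<Prod>b\<in>B. [:- b, 1:] ^ n)" if eq: "n * card B = d"
  proof (rule ccontr)
    define g where "g = (\<Prod>b\<in>B. [:- b, 1:] ^ n)"
    assume "f \<noteq> smult K (\<Prod>b\<in>B. [:- b, 1:] ^ n)"
    then have nz: "f - smult K g \<noteq> 0" by (simp add: g_def)
    have deg_g: "degree g = d"
      by (simp add: g_def degree_prod_eq_sum_degree degree_linear_power mult.commute flip: eq)
    moreover have "lead_coeff g = 1"
      unfolding g_def lead_coeff_prod by (intro prod.neutral ballI) (simp add: lead_coeff_power)
    ultimately have "coeff (f - smult K g) d = 0" using coeff_d by simp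
    moreover have "degree (f - smult K g) \<le> d"
      using deg deg_g degree_smult_le[of K g] by (intro degree_diff_le) auto
    ultimately have "degree (f - smult K g) < d"
      using nz d(1) by (metis eq_zero_or_degree_less)
    moreover have "n * card B \<le> degree (f - smult K g)"
    proof (rule card_mult_le_degree[OF B nz])
      fix b assume b: "b \<in> B"
      then have "[:- b, 1:] ^ n dvd g" unfolding g_def using B by (intro dvd_prodI)
      then show "[:- b, 1:] ^ n dvd f - smult K g" using dvd[OF b] by (simp add: dvd_smult)
    qed
    ultimately show False using eq by simp
  qed
  ultimately show thesis using c unfolding f_def K_def N_def by (intro that)
qed

section \<open>Summands with two or three elements\<close>

text \<open>Newton's identities between the lowest coefficients of \<open>f = (\<Prod>i. 1 - r i * x)\<close> and the power
  sums \<open>P1\<close>, \<open>P2\<close>, \<open>P3\<close> of the \<open>r i\<close>, without denominators.\<close>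

definition newton_coeffs :: "'a::comm_ring_1 poly \<Rightarrow> 'a \<Rightarrow> 'a \<Rightarrow> 'a \<Rightarrow> bool" where
  "newton_coeffs f P1 P2 P3 \<longleftrightarrow> coeff f 0 = 1 \<and> coeff f 1 = - P1 \<and>
     2 * coeff f 2 = P1 ^ 2 - P2 \<and> 6 * coeff f 3 = - (P1 ^ 3) + 3 * P1 * P2 - 2 * P3"

text \<open>A product joins the two families of \<open>r i\<close>, under which power sums
  add.\<close>

lemma newton_coeffs_mult:
  assumes "newton_coeffs f P1 P2 P3" "newton_coeffs g Q1 Q2 Q3"
  shows "newton_coeffs (f * g) (P1 + Q1) (P2 + Q2) (P3 + Q3)"
proof -
  have c: "coeff (f * g) 0 = coeff f 0 * coeff g 0"
    "coeff (f * g) 1 = coeff f 0 * coeff g 1 + coeff f 1 * coeff g 0"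
    "coeff (f * g) 2 = coeff f 0 * coeff g 2 + coeff f 1 * coeff g 1 + coeff f 2 * coeff g 0"
    "coeff (f * g) 3 = coeff f 0 * coeff g 3 + coeff f 1 * coeff g 2 + coeff f 2 * coeff g 1
       + coeff f 3 * coeff g 0"
    unfolding coeff_mult by (simp_all add: eval_nat_numeral)
  have f: "coeff f 0 = 1" "coeff f 1 = - P1" "2 * coeff f 2 = P1 ^ 2 - P2"
    "6 * coeff f 3 = - (P1 ^ 3) + 3 * P1 * P2 - 2 * P3"
    and g: "coeff g 0 = 1" "coeff g 1 = - Q1" "2 * coeff g 2 = Q1 ^ 2 - Q2"
    "6 * coeff g 3 = - (Q1 ^ 3) + 3 * Q1 * Q2 - 2 * Q3"
    using assms by (auto simp: newton_coeffs_def)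
  have "2 * coeff (f * g) 2 = 2 * coeff f 2 + 2 * P1 * Q1 + 2 * coeff g 2"
    unfolding c f(1,2) g(1,2) by (simp add: algebra_simps)
  moreover have "6 * coeff (f * g) 3
      = 6 * coeff f 3 - 3 * (2 * coeff f 2) * Q1 - 3 * P1 * (2 * coeff g 2) + 6 * coeff g 3"
    unfolding c f(1,2) g(1,2) by (simp add: algebra_simps)
  ultimately show ?thesis
    unfolding newton_coeffs_def f(3,4) g(3,4) using c(1,2) f(1,2) g(1,2)
    by (simp add: algebra_simps power2_eq_square power3_eq_cube)
qed

lemma newton_coeffs_1: "newton_coeffs 1 0 0 0"
  by (simp add: newton_coeffs_def coeff_1)

lemma newton_coeffs_linear: "newton_coeffs [:1, - b:] b (b ^ 2) (b ^ 3)"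
  by (simp add: newton_coeffs_def eval_nat_numeral)

lemma newton_coeffs_power:
  assumes "newton_coeffs f P1 P2 P3"
  shows "newton_coeffs (f ^ n) (of_nat n * P1) (of_nat n * P2) (of_nat n * P3)"
proof (induction n)
  case (Suc n)
  show ?case using newton_coeffs_mult[OF assms Suc] by (simp add: algebra_simps)
qed (simp add: newton_coeffs_1)

lemma newton_coeffs_prod:
  assumes "\<And>i. i \<in> I \<Longrightarrow> newton_coeffs (f i) (P1 i) (P2 i) (P3 i)"
  shows "newton_coeffs (prod f I) (sum P1 I) (sum P2 I) (sum P3 I)"
  using assms
  by (induction I rule: infinite_finite_induct) (auto simp: newton_coeffs_1 newton_coeffs_mult)

lemma reflect_poly_linear: "reflect_poly [:- b, 1:] = [:1, - b :: 'a::idom:]"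
proof (rule poly_eqI)
  fix i
  show "coeff (reflect_poly [:- b, 1:]) i = coeff [:1, - b:] i"
    by (cases i rule: nat.exhaust; cases "i - 1")
       (auto simp: coeff_reflect_poly coeff_pCons split: nat.splits)
qed

text \<open>Reversal turns \<open>x - b\<close> into \<open>1 - b * x\<close>, so Newton's
  identities for the lowest coefficients speak about the top coefficients of the original
  product.\<close>

lemma newton_coeffs_roots:
  fixes B :: "'a::idom set"
  shows "newton_coeffs (reflect_poly (\<Prod>b\<in>B. [:- b, 1:] ^ n))
    (of_nat n * (\<Sum>b\<in>B. b)) (of_nat n * (\<Sum>b\<in>B. b ^ 2)) (of_nat n * (\<Sum>b\<in>B. b ^ 3))"
  unfolding reflect_poly_prod reflect_poly_power reflect_poly_linear sum_distrib_left
  by (intro newton_coeffs_prod newton_coeffs_power newton_coeffs_linear)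

text \<open>Arguments are shifted to avoid subtraction of naturals and denominators are cleared, so
  that the identities can be cast into the field.\<close>

lemma binomial_small_lower:
  fixes x :: nat
  shows "2 * ((x + 2) choose 2) = (x + 2) * (x + 1)"
    "6 * ((x + 3) choose 3) = (x + 3) * (x + 2) * (x + 1)"
    "24 * ((x + 4) choose 4) = (x + 4) * (x + 3) * (x + 2) * (x + 1)"
    "120 * ((x + 5) choose 5) = (x + 5) * (x + 4) * (x + 3) * (x + 2) * (x + 1)"
proof -
  have suc: "Suc 1 = 2" "Suc (x + 1) = x + 2" "Suc 2 = 3" "Suc 3 = 4" "Suc 4 = 5"
    "Suc (x + 2) = x + 3" "Suc (x + 3) = x + 4" "Suc (x + 4) = x + 5" by simp_all
  have 2: "2 * ((x + 2) choose 2) = (x + 2) * (x + 1)"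
    using Suc_times_binomial[of 1 "x + 1"] by (simp only: suc choose_one)
  have 3: "3 * ((x + 3) choose 3) = (x + 3) * ((x + 2) choose 2)"
    using Suc_times_binomial[of 2 "x + 2"] by (simp only: suc)
  have 4: "4 * ((x + 4) choose 4) = (x + 4) * ((x + 3) choose 3)"
    using Suc_times_binomial[of 3 "x + 3"] by (simp only: suc)
  have 5: "5 * ((x + 5) choose 5) = (x + 5) * ((x + 4) choose 4)"
    using Suc_times_binomial[of 4 "x + 4"] by (simp only: suc)
  show "2 * ((x + 2) choose 2) = (x + 2) * (x + 1)" by (fact 2)
  have scale: "k * l * a = b * (l * c)" if "k * a = b * c" for k l a b c :: nat
    using that by (metis mult.assoc mult.left_commute)
  show 6: "6 * ((x + 3) choose 3) = (x + 3) * (x + 2) * (x + 1)"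
    using scale[OF 3, of 2] unfolding 2 by (simp only: mult.assoc, simp?)
  show 24: "24 * ((x + 4) choose 4) = (x + 4) * (x + 3) * (x + 2) * (x + 1)"
    using scale[OF 4, of 6] unfolding 6 by (simp only: mult.assoc, simp?)
  show "120 * ((x + 5) choose 5) = (x + 5) * (x + 4) * (x + 3) * (x + 2) * (x + 1)"
    using scale[OF 5, of 24] unfolding 24 by (simp only: mult.assoc, simp?)
qed

text \<open>In the Hanson-Petridis identity the coefficient of \<open>x ^ (d - j)\<close> contains
  on the left the complete homogeneous symmetric function \<open>h (n - 1 + j)\<close> of
  \<open>A\<close>, and on the right, by Newton's identities, power sums of \<open>B\<close>. The
  moments express the latter through power sums of \<open>A\<close>, so the elementary symmetric
  functions of \<open>A\<close> satisfy linear equations with nonzero coefficients.\<close>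

lemma no_small_summand_centered:
  fixes A B :: "'a::field set"
  assumes p: "prime CHAR('a)" and A: "finite A" "card A = 2 \<or> card A = 3" "(\<Sum>a\<in>A. a) = 0"
    and B: "finite B" and d: "card A * card B = d" "6 < d" "2 * d < CHAR('a)"
    and sums: "\<And>a b. a \<in> A \<Longrightarrow> b \<in> B \<Longrightarrow> (a + b) ^ d = 1"
    and moments: "\<And>j. 1 \<le> j \<Longrightarrow> j \<le> 3 \<Longrightarrow> (\<Sum>a\<in>A. \<Sum>b\<in>B. (a + b) ^ j) = 0"
  shows False
proof -
  define n where "n = card A"
  define N where "N = d + n - 1"
  define q where "q j = (\<Sum>a\<in>A. a ^ j)" for j
  define s where "s j = (\<Sum>b\<in>B. b ^ j)" for j
  define m where "m = (of_nat (card B) :: 'a)"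
  have n: "n = 2 \<or> n = 3" using A by (simp add: n_def)
  have neq0: "of_nat k \<noteq> (0 :: 'a)" if "0 < k" "k < CHAR('a)" for k
    using that by (auto simp: of_nat_eq_0_iff_char_dvd dest: dvd_imp_le)
  have nm: "of_nat n * m = of_nat d" using d(1) by (simp add: n_def m_def flip: of_nat_mult)
  have "A \<noteq> {}" using A(2) by auto
  have q1: "q 1 = 0" using A(3) by (simp add: q_def)
  have "m * q 1 + of_nat n * s 1 = 0"
    using moments[of 1] by (simp add: sum.distrib q_def s_def m_def n_def sum_distrib_left)
  then have s1: "s 1 = 0" using q1 neq0[of n] n d by auto
  have "(\<Sum>a\<in>A. \<Sum>b\<in>B. (a + b) ^ 2) = m * q 2 + 2 * q 1 * s 1 + of_nat n * s 2"
    unfolding power2_sum sum.distrib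
    by (simp add: q_def s_def m_def n_def sum_distrib_left sum_distrib_right algebra_simps)
  then have s2: "of_nat n * s 2 = - (m * q 2)" using moments[of 2] q1 by (simp add: eq_neg_iff_add_eq_0 add.commute)
  have "(\<Sum>a\<in>A. \<Sum>b\<in>B. (a + b) ^ 3) = (\<Sum>a\<in>A. \<Sum>b\<in>B. a ^ 3 + 3 * a ^ 2 * b + 3 * a * b ^ 2 + b ^ 3)"
    by (simp add: power3_eq_cube power2_eq_square algebra_simps)
  also have "\<dots> = m * q 3 + 3 * q 2 * s 1 + 3 * q 1 * s 2 + of_nat n * s 3"
    unfolding sum.distrib sum_product[symmetric]
    by (simp add: q_def s_def m_def n_def flip: sum_distrib_left)
  finally have s3: "of_nat n * s 3 = - (m * q 3)"
    using moments[of 3] q1 s1 by (simp add: eq_neg_iff_add_eq_0 add.commute)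
  obtain c where c: "\<And>j. j < n - 1 \<Longrightarrow> (\<Sum>a\<in>A. c a * a ^ j) = 0" "(\<Sum>a\<in>A. c a * a ^ (n - 1)) = 1"
    and id': "n * card B = d \<Longrightarrow> (\<Sum>a\<in>A. smult (c a) ([:a, 1:] ^ N)) - 1
       = smult (of_nat (N choose d)) (\<Prod>b\<in>B. [:- b, 1:] ^ n)"
  proof (rule hanson_petridis[OF p A(1) \<open>A \<noteq> {}\<close> B, of d])
    show "0 < d" "d + card A \<le> CHAR('a)" using d n by (auto simp: n_def)
    show "\<And>a b. a \<in> A \<Longrightarrow> b \<in> B \<Longrightarrow> (a + b) ^ d = 1" by (fact sums)
    fix c
    assume "\<And>j. j < card A - 1 \<Longrightarrow> (\<Sum>a\<in>A. c a * a ^ j) = 0"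
      "(\<Sum>a\<in>A. c a * a ^ (card A - 1)) = 1"
      "card A * card B = d \<Longrightarrow> (\<Sum>a\<in>A. smult (c a) ([:a, 1:] ^ (d + card A - 1))) - 1
        = smult (of_nat ((d + card A - 1) choose d)) (\<Prod>b\<in>B. [:- b, 1:] ^ card A)"
    then show thesis unfolding n_def[symmetric] N_def[symmetric] by (rule that)
  qed
  define g where "g = (\<Prod>b\<in>B. [:- b, 1:] ^ n)"
  define h where "h j = (\<Sum>a\<in>A. c a * a ^ j)" for j
  have id: "(\<Sum>a\<in>A. smult (c a) ([:a, 1:] ^ N)) - 1 = smult (of_nat (N choose d)) g"
    using id' d(1) by (simp add: n_def g_def)
  have deg: "degree g = d"
    using d(1) by (simp add: g_def degree_prod_eq_sum_degree degree_linear_power n_def mult.commute)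
  have coeff: "of_nat (N choose (d - j)) * h (n - 1 + j) = of_nat (N choose d) * coeff (reflect_poly g) j"
    if "0 < j" "j \<le> 3" for j
  proof -
    have "coeff (\<Sum>a\<in>A. smult (c a) ([:a, 1:] ^ N)) (d - j) = of_nat (N choose d) * coeff g (d - j)"
      using arg_cong[OF id, of "\<lambda>f. coeff f (d - j)"] that d by (simp add: coeff_1)
    moreover have "N - (d - j) = n - 1 + j" using that d n by (auto simp: N_def)
    ultimately show ?thesis using that d deg
      unfolding coeff_shifted_power_sum h_def by (simp add: coeff_reflect_poly)
  qed
  have newton: "2 * coeff (reflect_poly g) 2 = m * q 2" "6 * coeff (reflect_poly g) 3 = 2 * m * q 3"
    using newton_coeffs_roots[of n B] s1 s2 s3 unfolding newton_coeffs_def g_def s_def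
    by (simp_all add: algebra_simps)
  have idx: "n - 1 + 2 = n + 1" "n - 1 + 3 = n + 2" using n by auto
  have e2: "2 * of_nat (N choose (d - 2)) * h (n + 1) = of_nat (N choose d) * (m * q 2)"
    using coeff[of 2] unfolding newton(1)[symmetric] idx by simp
  have e3: "6 * of_nat (N choose (d - 3)) * h (n + 2) = of_nat (N choose d) * (2 * m * q 3)"
    using coeff[of 3] unfolding newton(2)[symmetric] idx by simp
  show False
    using n
  proof
    assume n2: "n = 2"
    obtain u v where uv: "A = {u, v}" "u \<noteq> v" using n2 by (auto simp: n_def card_2_iff)
    then have v: "v = - u" using A(3) by (simp add: eq_neg_iff_add_eq_0 add.commute)
    have "u \<noteq> 0" using uv v by auto
    have q2: "q 2 = 2 * u ^ 2" using uv by (simp add: q_def v)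
    have "h 3 = u ^ 2 * h 1"
      using uv by (simp add: h_def v power2_eq_square power3_eq_cube algebra_simps)
    then have h3: "h 3 = u ^ 2" using c(2) by (simp add: h_def n2)
    define x where "x = d - 2"
    have x: "d = x + 2" "N = x + 3" using d by (auto simp: x_def N_def n2)
    have b: "N choose (d - 2) = (x + 3) choose 3" "N choose d = x + 3"
      using binomial_symmetric[of x "x + 3"] binomial_symmetric[of "x + 2" "x + 3"] x by auto
    define X where "X = (of_nat x :: 'a)"
    note cast = of_nat_mult of_nat_add of_nat_numeral of_nat_1 X_def
    have B3: "6 * of_nat ((x + 3) choose 3) = (X + 3) * (X + 2) * (X + 1)"
      using arg_cong[OF binomial_small_lower(2)[of x], of "of_nat :: nat \<Rightarrow> 'a"]
      by (simp only: cast)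
    have M: "2 * m = X + 2" using nm by (simp add: n2 x X_def)
    have "n + 1 = 3" using n2 by simp
    from e2[unfolded b q2 this] have e2': "2 * of_nat ((x + 3) choose 3) * h 3 = (X + 3) * (m * (2 * u ^ 2))"
      by (simp only: cast)
    have "6 * of_nat ((x + 3) choose 3) * u ^ 2 = 3 * (2 * of_nat ((x + 3) choose 3) * h 3)"
      by (simp add: h3)
    also have "\<dots> = 3 * (X + 3) * (2 * m) * u ^ 2"
      unfolding e2' by (simp add: algebra_simps)
    finally have "(X + 3) * (X + 2) * (X - 2) * u ^ 2 = 0"
      unfolding B3 M by (simp add: algebra_simps)
    \<comment> \<open>In the field these are \<open>d + 1\<close>, \<open>d\<close> and
      \<open>d - 4\<close>.\<close>
    moreover have "X + 3 \<noteq> 0" "X + 2 \<noteq> 0" "X - 2 \<noteq> 0"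
      using neq0[of "x + 3"] neq0[of "x + 2"] neq0[of "x - 2"] d x by (auto simp: X_def ac_simps)
    ultimately show False using \<open>u \<noteq> 0\<close> by simp
  next
    assume n3: "n = 3"
    obtain u v w where uvw: "A = {u, v, w}" "u \<noteq> v" "v \<noteq> w" "u \<noteq> w"
      using n3 by (auto simp: n_def card_3_iff)
    define E2 where "E2 = u * v + v * w + u * w"
    define E3 where "E3 = u * v * w"
    have w: "w = - u - v" using A(3) uvw by (simp add: algebra_simps eq_neg_iff_add_eq_0)
    \<comment> \<open>\<open>A\<close> is the root set of \<open>t ^ 3 + E2 * t - E3\<close>, which
      yields a recurrence for \<open>h\<close>.\<close>
    have cube: "a ^ 3 = E3 - E2 * a" if "a \<in> A" for a
      using that uvw(1) unfolding E2_def E3_def w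
      by (auto simp: power3_eq_cube algebra_simps)
    have q2: "q 2 = - 2 * E2" and q3: "q 3 = 3 * E3"
      using uvw by (simp_all add: q_def E2_def E3_def w power3_eq_cube power2_eq_square algebra_simps)
    have c0: "h 0 = 0" "h 1 = 0" "h 2 = 1" using c(1)[of 0] c(1)[of 1] c(2) by (simp_all add: h_def n3)
    have rec: "h (j + 3) = E3 * h j - E2 * h (j + 1)" for j
    proof -
      have "h (j + 3) = (\<Sum>a\<in>A. c a * (a ^ j * (E3 - E2 * a)))"
        unfolding h_def power_add by (intro sum.cong refl) (simp add: cube)
      also have "\<dots> = E3 * h j - E2 * h (j + 1)"
        by (simp add: h_def sum_distrib_left sum_subtractf[symmetric] algebra_simps)
      finally show ?thesis .
    qed
    have h3: "h 3 = 0" "h 4 = - E2" using rec[of 0] rec[of 1] c0 by (simp_all add: numeral_eq_Suc)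
    have h5: "h 5 = E3 - E2 * h 3" using rec[of 2] c0 by (simp add: numeral_eq_Suc)
    define x where "x = d - 3"
    have x: "d = x + 3" "N = x + 5" using d by (auto simp: x_def N_def n3)
    have b: "N choose (d - 2) = (x + 5) choose 4" "N choose (d - 3) = (x + 5) choose 5"
        "N choose d = (x + 5) choose 2"
      using binomial_symmetric[of "x + 1" "x + 5"] binomial_symmetric[of x "x + 5"]
        binomial_symmetric[of "x + 3" "x + 5"] x by auto
    define X where "X = (of_nat x :: 'a)"
    note cast = of_nat_mult of_nat_add of_nat_numeral of_nat_1 X_def
    have eq: "x + 3 + 2 = x + 5" "x + 3 + 1 = x + 4" "x + 1 + 4 = x + 5" "x + 1 + 3 = x + 4"
      "x + 1 + 2 = x + 3" "x + 1 + 1 = x + 2" by simp_all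
    have B2: "2 * of_nat ((x + 5) choose 2) = (X + 5) * (X + 4)"
      using arg_cong[OF binomial_small_lower(1)[of "x + 3", unfolded eq], of "of_nat :: nat \<Rightarrow> 'a"]
      by (simp only: cast)
    have B4: "24 * of_nat ((x + 5) choose 4) = (X + 5) * (X + 4) * (X + 3) * (X + 2)"
      using arg_cong[OF binomial_small_lower(3)[of "x + 1", unfolded eq], of "of_nat :: nat \<Rightarrow> 'a"]
      by (simp only: cast)
    have B5: "120 * of_nat ((x + 5) choose 5) = (X + 5) * (X + 4) * (X + 3) * (X + 2) * (X + 1)"
      using arg_cong[OF binomial_small_lower(4)[of x], of "of_nat :: nat \<Rightarrow> 'a"]
      by (simp only: cast)
    have M: "3 * m = X + 3" using nm by (simp add: n3 x X_def)
    \<comment> \<open>The last factor \<open>X - 3\<close> is \<open>d - 6\<close>, which accounts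
      for the hypothesis \<open>6 < d\<close>.\<close>
    have nz: "X + 5 \<noteq> 0" "X + 4 \<noteq> 0" "X + 3 \<noteq> 0" "X - 2 \<noteq> 0" "X + 6 \<noteq> 0" "X - 3 \<noteq> 0"
      using neq0[of "x + 5"] neq0[of "x + 4"] neq0[of "x + 3"] neq0[of "x - 2"] neq0[of "x + 6"]
        neq0[of "x - 3"] d x by (auto simp: X_def ac_simps)
    have n12: "n + 1 = 4" "n + 2 = 5" using n3 by simp_all
    have "24 * of_nat ((x + 5) choose 4) * E2 = - 12 * (2 * of_nat ((x + 5) choose 4) * h 4)"
      by (simp add: h3)
    also have "\<dots> = 4 * (2 * of_nat ((x + 5) choose 2)) * (3 * m) * E2"
      unfolding e2[unfolded b q2 n12] by (simp add: algebra_simps)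
    finally have "(X + 5) * (X + 4) * (X + 3) * (X - 2) * E2 = 0"
      unfolding B4 B2 M by (simp add: algebra_simps)
    then have E2: "E2 = 0" using nz by simp
    have "120 * of_nat ((x + 5) choose 5) * E3 = 20 * (6 * of_nat ((x + 5) choose 5) * h 5)"
      by (simp add: h5 E2)
    also have "\<dots> = 20 * (2 * of_nat ((x + 5) choose 2)) * (3 * m) * E3"
      unfolding e3[unfolded b q3 n12] by (simp add: algebra_simps)
    finally have "(X + 5) * (X + 4) * (X + 3) * ((X + 6) * (X - 3)) * E3 = 0"
      unfolding B5 B2 M by (simp add: algebra_simps)
    then have "E3 = 0" using nz by simp
    then have "a = 0" if "a \<in> A" for a using cube[OF that] E2 by simp
    then show False using uvw by auto
  qed
qed

text \<open>Shifting \<open>A\<close> by \<open>- t\<close> and \<open>B\<close> by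
  \<open>t\<close>, with \<open>t\<close> the mean of \<open>A\<close>, leaves all sums
  \<open>a + b\<close> unchanged.\<close>

lemma no_small_summand:
  fixes A B :: "'a::field set"
  assumes p: "prime CHAR('a)" and A: "finite A" "card A = 2 \<or> card A = 3"
    and B: "finite B" and d: "card A * card B = d" "6 < d" "2 * d < CHAR('a)"
    and sums: "\<And>a b. a \<in> A \<Longrightarrow> b \<in> B \<Longrightarrow> (a + b) ^ d = 1"
    and moments: "\<And>j. 1 \<le> j \<Longrightarrow> j \<le> 3 \<Longrightarrow> (\<Sum>a\<in>A. \<Sum>b\<in>B. (a + b) ^ j) = 0"
  shows False
proof -
  define t where "t = (\<Sum>a\<in>A. a) / of_nat (card A)"
  have "of_nat (card A) \<noteq> (0 :: 'a)"
    using A(2) d by (auto simp: of_nat_eq_0_iff_char_dvd simp del: of_nat_numeral dest!: dvd_imp_le)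
  then have t: "of_nat (card A) * t = (\<Sum>a\<in>A. a)" by (simp add: t_def)
  have inj: "inj_on (\<lambda>a. a - t) A" "inj_on (\<lambda>b. b + t) B" by (auto simp: inj_on_def)
  show False
  proof (rule no_small_summand_centered[OF p, of "(\<lambda>a. a - t) ` A" "(\<lambda>b. b + t) ` B" d])
    show "card ((\<lambda>a. a - t) ` A) = 2 \<or> card ((\<lambda>a. a - t) ` A) = 3"
      using A(2) by (simp add: card_image[OF inj(1)])
    show "card ((\<lambda>a. a - t) ` A) * card ((\<lambda>b. b + t) ` B) = d"
      using d(1) by (simp add: card_image[OF inj(1)] card_image[OF inj(2)])
    show "(\<Sum>a\<in>(\<lambda>a. a - t) ` A. a) = 0"
      using t by (simp add: sum.reindex[OF inj(1)] sum_subtractf)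
    show "(\<Sum>a\<in>(\<lambda>a. a - t) ` A. \<Sum>b\<in>(\<lambda>b. b + t) ` B. (a + b) ^ j) = 0"
      if "1 \<le> j" "j \<le> 3" for j
      using moments[OF that] by (simp add: sum.reindex[OF inj(1)] sum.reindex[OF inj(2)])
    show "(a + b) ^ d = 1" if "a \<in> (\<lambda>a. a - t) ` A" "b \<in> (\<lambda>b. b + t) ` B" for a b
      using that sums by auto
  qed (use A B d in auto)
qed

section \<open>Additive decompositions of multiplicative subgroups\<close>

lemma power_card_eq_1:
  fixes G :: "'a::field set"
  assumes "finite G" "0 \<notin> G" "\<And>x y. x \<in> G \<Longrightarrow> y \<in> G \<Longrightarrow> x * y \<in> G" "x \<in> G"
  shows "x ^ card G = 1"
proof -
  have inj: "inj_on ((*) x) G" using assms(2,4) by (auto simp: inj_on_def)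
  have img: "(*) x ` G = G" using assms inj by (intro endo_inj_surj) auto
  have "\<Prod>G = (\<Prod>g\<in>(*) x ` G. g)" by (simp add: img)
  also have "\<dots> = x ^ card G * \<Prod>G" by (simp add: prod.reindex[OF inj] prod.distrib)
  finally show ?thesis using assms(1,2) by (simp add: prod_zero_iff)
qed

text \<open>The equation \<open>x ^ j = 1\<close> has at most \<open>j\<close> solutions, so it
  fails for some \<open>x\<close> in \<open>G\<close>. Multiplication by this \<open>x\<close>
  permutes \<open>G\<close> and multiplies the sum by \<open>x ^ j\<close>.\<close>

lemma power_sum_eq_0:
  fixes G :: "'a::field set"
  assumes "finite G" "0 \<notin> G" "\<And>x y. x \<in> G \<Longrightarrow> y \<in> G \<Longrightarrow> x * y \<in> G" "0 < j" "j < card G"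
  shows "(\<Sum>g\<in>G. g ^ j) = 0"
proof -
  have "\<exists>x\<in>G. x ^ j \<noteq> 1"
  proof (rule ccontr)
    assume "\<not> ?thesis"
    then have "[:- x, 1:] ^ 1 dvd monom 1 j - 1" if "x \<in> G" for x
      using that by (simp add: poly_monom flip: poly_eq_0_iff_dvd)
    moreover have "coeff (monom 1 j - 1 :: 'a poly) j = 1" using assms(4) by (simp add: coeff_1)
    then have "monom 1 j - 1 \<noteq> (0 :: 'a poly)" by (metis coeff_0 zero_neq_one)
    ultimately have "1 * card G \<le> degree (monom 1 j - 1 :: 'a poly)"
      by (intro card_mult_le_degree assms(1))
    also have "\<dots> \<le> j" by (intro degree_diff_le) (auto simp: degree_monom_le)
    finally show False using assms(5) by simp
  qed
  then obtain x where x: "x \<in> G" "x ^ j \<noteq> 1" by auto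
  have inj: "inj_on ((*) x) G" using assms(2) x(1) by (auto simp: inj_on_def)
  have img: "(*) x ` G = G" using assms inj x by (intro endo_inj_surj) auto
  have "(\<Sum>g\<in>G. g ^ j) = (\<Sum>g\<in>(*) x ` G. g ^ j)" by (simp add: img)
  also have "\<dots> = x ^ j * (\<Sum>g\<in>G. g ^ j)"
    by (simp add: sum.reindex[OF inj] power_mult_distrib sum_distrib_left)
  finally have "(x ^ j - 1) * (\<Sum>g\<in>G. g ^ j) = 0" by (simp add: algebra_simps)
  then show ?thesis using x by simp
qed

text \<open>\<open>k\<close> is the least number for which the \<open>S\<close> subsets of size at most 2 allow a vanishing order
  \<open>M\<close>, about \<open>5 S / 6\<close>, above \<open>2 n\<close>. Then \<open>k ^ 2\<close> and \<open>S\<close> are \<open>O(n)\<close>, and all error terms are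
  \<open>O(n powr (5/2)) = O(d powr (5/6))\<close>.\<close>

lemma stepanov_parameters:
  fixes n d :: nat
  assumes n: "4 \<le> n" "n ^ 3 \<le> d" and d: "10 ^ 22 \<le> d"
  obtains k S M D where "k \<le> n" "2 * S = k ^ 2 + k + 2" "2 * n + 1 \<le> M" "M < d"
    "M * (D + M * k) < S * D" "(S + 1) * (D + k * S) \<le> d" "n * D < d"
proof -
  \<comment> \<open>For the \<open>S\<close> belonging to \<open>k\<close> this says
    \<open>6 * (2 * n + 1) \<le> 5 * S\<close>.\<close>
  define P where "P k \<longleftrightarrow> 24 * n + 12 \<le> 5 * (k ^ 2 + k + 2)" for k
  have "24 * n + 12 \<le> 5 * (m + n + 2)" if "4 * n \<le> m" for m using that n(1) by simp
  from this[of "n * n"] n(1) have "P n" unfolding P_def power2_eq_square by (metis mult_le_mono1)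
  define k where "k = (LEAST k. P k)"
  have "P k" unfolding k_def using \<open>P n\<close> by (rule LeastI)
  have "k \<le> n" unfolding k_def using \<open>P n\<close> by (rule Least_le)
  have k2: "2 \<le> k"
  proof (rule ccontr)
    assume "\<not> 2 \<le> k"
    then have "k = 0 \<or> k = 1" by auto
    then show False using \<open>P k\<close> n by (auto simp: P_def)
  qed
  have "\<not> P (k - 1)" unfolding k_def[symmetric] using not_less_Least[of "k - 1" P] k2 by (simp add: k_def)
  moreover obtain l where l: "k = Suc l" using k2 by (cases k) auto
  ultimately have "5 * (l ^ 2 + l + 2) < 24 * n + 12" by (simp add: P_def)
  then have k_sq: "k ^ 2 \<le> 10 * n"
    using k2 n unfolding l power2_eq_square
  proof -
    assume *: "5 * (l * l + l + 2) < 24 * n + 12"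
    have "l \<le> l * l" using k2 l by simp
    then show "Suc l * Suc l \<le> 10 * n" using * n(1) by simp
  qed
  have "even (k ^ 2 + k + 2)" by simp
  then obtain S where S: "k ^ 2 + k + 2 = 2 * S" by (elim evenE)
  have "2 * k \<le> k ^ 2" using k2 by (simp add: power2_eq_square)
  then have S_le: "S \<le> 10 * n" using S k_sq k2 by linarith
  have S_ge: "12 * n + 6 \<le> 5 * S" using \<open>P k\<close> S by (simp add: P_def)
  define M where "M = 5 * S div 6"
  have M: "2 * n + 1 \<le> M" "6 * M \<le> 5 * S" using S_ge by (auto simp: M_def)
  \<comment> \<open>With \<open>6 * M \<le> 5 * S\<close> this gives
    \<open>M * (5 * S + M) \<le> 175 / 36 * S ^ 2 < 5 * S ^ 2\<close>, the excess of unknowns over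
    equations after division by \<open>k\<close>.\<close>
  define D where "D = 5 * S * k"
  have "S > 0" using S by (cases S) auto
  have small: "12 * k * S ^ 2 < d"
  proof -
    have pow5: "x * x ^ 4 = x ^ 5" for x :: nat by (simp add: eval_nat_numeral)
    \<comment> \<open>Squaring brings in \<open>k ^ 2 \<le> 10 * n\<close>, and cubing the result
      brings in \<open>n ^ 3 \<le> d\<close>. The threshold \<open>10 ^ 22\<close> is a round number
      above \<open>144 ^ 3 * 10 ^ 15\<close>.\<close>
    have "(12 * k * S ^ 2) ^ 2 = 144 * (k ^ 2 * S ^ 4)" by (simp add: power_mult_distrib flip: power_mult)
    also have "\<dots> \<le> 144 * ((10 * n) * (10 * n) ^ 4)"
      using k_sq S_le by (intro mult_mono power_mono) auto
    finally have "((12 * k * S ^ 2) ^ 2) ^ 3 \<le> (144 * (10 * n) ^ 5) ^ 3"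
      unfolding pow5 by (intro power_mono) auto
    also have "\<dots> = 144 ^ 3 * 10 ^ 15 * (n ^ 3) ^ 5" by (simp add: power_mult_distrib flip: power_mult)
    also have "\<dots> \<le> 144 ^ 3 * 10 ^ 15 * d ^ 5" using n(2) by (intro mult_left_mono power_mono) auto
    also have "\<dots> < d * d ^ 5"
    proof (rule mult_strict_right_mono)
      have "144 ^ 3 * 10 ^ 15 < (10 ^ 22 :: nat)" by simp
      then show "144 ^ 3 * 10 ^ 15 < d" using d by linarith
      show "0 < d ^ 5" using d by (cases d) auto
    qed
    finally have "(12 * k * S ^ 2) ^ 6 < d ^ 6" unfolding power_mult[symmetric] power_Suc[symmetric] by simp
    then show ?thesis by (rule power_less_imp_less_base) simp
  qed
  show thesis
  proof (rule that[of k S M D])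
    show "k \<le> n" by fact
    show "2 * S = k ^ 2 + k + 2" "2 * n + 1 \<le> M" using S M by auto
    have "S * 1 \<le> S * (12 * k * S)" using \<open>S > 0\<close> k2 by (intro mult_left_mono) auto
    also have "S * (12 * k * S) = 12 * k * S ^ 2" by (simp add: power2_eq_square)
    finally have "S < d" using small by simp
    then show "M < d" using M by linarith
    have "36 * (M * (5 * S + M)) = 6 * M * (6 * (5 * S) + 6 * M)" by (simp add: algebra_simps)
    also have "\<dots> \<le> 5 * S * (6 * (5 * S) + 5 * S)" by (rule mult_le_mono[OF M(2) add_left_mono[OF M(2)]])
    also have "\<dots> < 36 * (5 * S * S)" using \<open>S > 0\<close> by simp
    finally have "M * (5 * S + M) * k < 5 * S * S * k" using k2 by simp
    then show "M * (D + M * k) < S * D" by (simp add: D_def algebra_simps)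
    have "(S + 1) * (D + k * S) = 6 * k * S * (S + 1)" by (simp add: D_def algebra_simps)
    also have "\<dots> \<le> 6 * k * S * (2 * S)" using \<open>S > 0\<close> by (intro mult_left_mono) auto
    also have "\<dots> = 12 * k * S ^ 2" by (simp add: power2_eq_square)
    finally show "(S + 1) * (D + k * S) \<le> d" using small by simp
    have "n * D = 5 * k * S * n" by (simp add: D_def)
    also have "\<dots> \<le> 5 * k * S * S" using S_ge by (intro mult_left_mono) auto
    also have "\<dots> \<le> 12 * k * S ^ 2" by (simp add: power2_eq_square)
    finally show "n * D < d" using small by simp
  qed
qed

lemma card_subsets_le_2:
  assumes "finite A" "card A = k"
  shows "2 * card {s. s \<subseteq> A \<and> card s \<le> 2} = k ^ 2 + k + 2"
proof -
  let ?F = "\<lambda>i. {s. s \<subseteq> A \<and> card s = i}"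
  have F: "{s. s \<subseteq> A \<and> card s \<le> 2} = ?F 0 \<union> (?F 1 \<union> ?F 2)"
    by (auto simp: le_Suc_eq numeral_2_eq_2)
  have fin: "finite (?F i)" for i using assms(1) by simp
  have "card {s. s \<subseteq> A \<and> card s \<le> 2} = card (?F 0) + (card (?F 1) + card (?F 2))"
    unfolding F using fin by (subst card_Un_disjoint; (subst card_Un_disjoint)?; auto)
  also have "\<dots> = 1 + (k + (k choose 2))"
    using assms by (simp add: n_subsets)
  finally have c: "card {s. s \<subseteq> A \<and> card s \<le> 2} = 1 + (k + (k choose 2))" .
  have "even (k * (k - 1))" by (cases k) auto
  then have "2 * (k choose 2) = k * (k - 1)" by (simp add: choose_two)
  then show ?thesis unfolding c by (cases k) (auto simp: power2_eq_square)
qed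

text \<open>Closure under products makes a finite nonempty set of units a subgroup. The last
  assumption is what properness amounts to in the prime field, where the index is at least
  2.\<close>

locale multiplicative_subgroup =
  fixes G :: "'a::field set"
  assumes prime_CHAR: "prime CHAR('a)"
    and finite: "finite G" and nonempty: "G \<noteq> {}" and zero: "0 \<notin> G"
    and mult_closed: "\<And>x y. x \<in> G \<Longrightarrow> y \<in> G \<Longrightarrow> x * y \<in> G"
    and proper: "2 * card G < CHAR('a)"
begin

lemma summands_finite:
  assumes "G = A + B"
  shows "finite A" "finite B" "A \<noteq> {}" "B \<noteq> {}" "card A \<le> card G"
proof -
  show ne: "A \<noteq> {}" "B \<noteq> {}" using nonempty assms by (auto simp: set_plus_def)
  then obtain a b where ab: "a \<in> A" "b \<in> B" by auto
  have sub: "(\<lambda>x. x + b) ` A \<subseteq> G" "(\<lambda>y. a + y) ` B \<subseteq> G" using ab by (auto simp: assms)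
  have inj: "inj_on (\<lambda>x. x + b) A" "inj_on (\<lambda>y. a + y) B" by (auto simp: inj_on_def)
  show "finite A" "finite B"
    using inj sub finite by (meson finite_imageD finite_subset)+
  show "card A \<le> card G" using card_mono[OF finite sub(1)] by (simp add: card_image[OF inj(1)])
qed

lemma sum_power:
  assumes "G = A + B" "a \<in> A" "b \<in> B"
  shows "(a + b) ^ card G = 1"
  using assms finite zero mult_closed by (intro power_card_eq_1) auto

text \<open>The Hanson-Petridis bound is the upper estimate; the lower one holds because the sums
  cover \<open>G\<close>.\<close>

lemma card_mult_summands:
  assumes G: "G = A + B"
  shows "card A * card B = card G"
proof (rule antisym)
  note fin = summands_finite[OF G]
  have "0 < card G" using finite nonempty by (simp add: card_gt_0_iff)
  then show "card A * card B \<le> card G"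
    using hanson_petridis[OF prime_CHAR fin(1,3,2), of "card G"] fin(5) proper sum_power[OF G] by simp
  have "G = (\<lambda>(a, b). a + b) ` (A \<times> B)" by (simp add: G set_plus_image)
  then show "card G \<le> card A * card B"
    using card_image_le[of "A \<times> B" "\<lambda>(a, b). a + b"] fin by (simp add: card_cartesian_product)
qed

lemma summands_inj:
  assumes G: "G = A + B"
  shows "inj_on (\<lambda>(a, b). a + b) (A \<times> B)"
  using card_mult_summands[OF G] summands_finite[OF G] G
  by (intro eq_card_imp_inj_on) (auto simp: card_cartesian_product set_plus_image)

text \<open>If \<open>card A \<ge> 4\<close>, Stepanov's bound gives
  \<open>M * card B \<le> 2 * card G + D\<close>. Multiplied by \<open>card A\<close> this
  contradicts \<open>M \<ge> 2 * card A + 1\<close> and \<open>card A * D < card G\<close>.\<close>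

theorem no_unbalanced_summands:
  assumes G: "G = A + B" and A: "2 \<le> card A" "card A ^ 3 \<le> card G" and d: "10 ^ 22 \<le> card G"
  shows False
proof (cases "card A \<le> 3")
  case True
  note fin = summands_finite[OF G]
  show False
  proof (rule no_small_summand[OF prime_CHAR fin(1) _ fin(2) card_mult_summands[OF G]])
    show "card A = 2 \<or> card A = 3" using A True by auto
    show "6 < card G" using d by simp
    show "2 * card G < CHAR('a)" by (fact proper)
    show "(a + b) ^ card G = 1" if "a \<in> A" "b \<in> B" for a b using sum_power[OF G that] .
    fix j :: nat assume j: "1 \<le> j" "j \<le> 3"
    have "(\<Sum>a\<in>A. \<Sum>b\<in>B. (a + b) ^ j) = (\<Sum>(a, b)\<in>A \<times> B. (a + b) ^ j)"
      by (simp add: sum.cartesian_product)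
    also have "\<dots> = (\<Sum>g\<in>G. g ^ j)"
      using sum.reindex[OF summands_inj[OF G], of "\<lambda>g. g ^ j"]
      by (simp add: G set_plus_image case_prod_unfold)
    also have "\<dots> = 0"
      using j d finite zero mult_closed by (intro power_sum_eq_0) auto
    finally show "(\<Sum>a\<in>A. \<Sum>b\<in>B. (a + b) ^ j) = 0" .
  qed
next
  case False
  note fin = summands_finite[OF G]
  have "4 \<le> card A" using False by simp
  obtain k S M D where par: "k \<le> card A" "2 * S = k ^ 2 + k + 2" "2 * card A + 1 \<le> M" "M < card G"
    "M * (D + M * k) < S * D" "(S + 1) * (D + k * S) \<le> card G" "card A * D < card G"
    by (rule stepanov_parameters[OF \<open>4 \<le> card A\<close> A(2) d], rule that)
  \<comment> \<open>With all of \<open>A\<close> as shifts, \<open>k * S ^ 2\<close> would be of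
    order \<open>card A ^ 5\<close>, which may exceed \<open>card G\<close>.\<close>
  obtain A' where A': "A' \<subseteq> A" "card A' = k" using par(1) by (meson obtain_subset_with_card_n)
  have "finite A'" using A' fin by (meson finite_subset)
  define F where "F = {s. s \<subseteq> A' \<and> card s \<le> 2}"
  have "2 * card F = 2 * S"
    using card_subsets_le_2[OF \<open>finite A'\<close> A'(2)] par(2) by (simp add: F_def)
  then have "card F = S" by simp
  have "M * card B \<le> 2 * card G + D"
  proof (rule stepanov_bound[OF prime_CHAR _ \<open>finite A'\<close> _ _ \<open>card F = S\<close> _ par(5) _ par(6) fin(2)])
    show "(a + b) ^ card G = 1" if "a \<in> A'" "b \<in> B" for a b using sum_power[OF G] that A' by auto
  qed (use proper par A' in \<open>auto simp: F_def\<close>)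
  then have "M * card G \<le> card A * (2 * card G + D)"
    using card_mult_summands[OF G] mult_left_mono[of "M * card B" "2 * card G + D" "card A"]
    by (simp add: mult.left_commute)
  moreover have "(2 * card A + 1) * card G \<le> M * card G" using par(3) by (intro mult_right_mono) auto
  ultimately show False using par(7) by (simp add: algebra_simps)
qed

theorem no_three_summands:
  assumes G: "G = A + B + C" and card: "2 \<le> card A" "2 \<le> card B" "2 \<le> card C"
    and d: "10 ^ 22 \<le> card G"
  shows False
proof -
  have GA: "G = A + (B + C)" and GB: "G = B + (A + C)" and GC: "G = C + (A + B)"
    by (simp_all add: G ac_simps)
  obtain a where "a \<in> A" using card(1) by fastforce
  \<comment> \<open>Adding a fixed \<open>a\<close> turns a coincidence in \<open>B + C\<close> into
    one in \<open>C + (A + B)\<close>, where sums are distinct.\<close>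
  have "inj_on (\<lambda>(b, c). b + c) (B \<times> C)"
  proof (rule inj_onI, clarify)
    fix b c b' c' assume H: "b \<in> B" "c \<in> C" "b' \<in> B" "c' \<in> C" "b + c = b' + c'"
    then have "c + (a + b) = c' + (a + b')" by (simp add: ac_simps)
    moreover have "a + b \<in> A + B" "a + b' \<in> A + B" using \<open>a \<in> A\<close> H by auto
    ultimately have "c = c' \<and> a + b = a + b'"
      using inj_onD[OF summands_inj[OF GC], of "(c, a + b)" "(c', a + b')"] H by auto
    then show "b = b' \<and> c = c'" by simp
  qed
  then have "card (B + C) = card B * card C"
    by (simp add: set_plus_image card_image card_cartesian_product)
  then have prod: "card A * (card B * card C) = card G" using card_mult_summands[OF GA] by simp
  have cube: "x ^ 3 \<le> card G" if "x \<le> card A" "x \<le> card B" "x \<le> card C" for x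
  proof -
    have "x * (x * x) \<le> card A * (card B * card C)" using that by (intro mult_mono) auto
    then show ?thesis by (simp add: prod power3_eq_cube mult.assoc)
  qed
  consider "card A \<le> card B \<and> card A \<le> card C" | "card B \<le> card A \<and> card B \<le> card C"
    | "card C \<le> card A \<and> card C \<le> card B" by linarith
  then show False
  proof cases
    case 1
    then show False using no_unbalanced_summands[OF GA card(1) _ d] cube by simp
  next
    case 2
    then show False using no_unbalanced_summands[OF GB card(2) _ d] cube by simp
  next
    case 3
    then show False using no_unbalanced_summands[OF GC card(3) _ d] cube by simp
  qed
qed

end

section \<open>Transfer to residue rings\<close>

text \<open>A counterexample above the threshold, phrased as a property of \<open>p\<close> alone so
  that it passes to the cardinality of a type.\<close>

definition exceptional_prime :: "nat \<Rightarrow> bool" where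
  "exceptional_prime p \<longleftrightarrow> prime p \<and> (\<exists>G A B C :: int set.
     subgroup G (mult_of (residue_ring (int p))) \<and>
     G \<noteq> carrier (mult_of (residue_ring (int p))) \<and> 10 ^ 22 \<le> card G \<and>
     A \<subseteq> carrier (residue_ring (int p)) \<and>
     B \<subseteq> carrier (residue_ring (int p)) \<and>
     C \<subseteq> carrier (residue_ring (int p)) \<and>
     card A \<ge> 2 \<and> card B \<ge> 2 \<and> card C \<ge> 2 \<and>
     G = A <+>\<^bsub>residue_ring (int p)\<^esub> B <+>\<^bsub>residue_ring (int p)\<^esub> C)"

text \<open>By Lagrange's theorem the index in the group of order \<open>p - 1\<close> is at least
  2.\<close>

lemma twice_card_proper_subgroup:
  assumes p: "prime p" and G: "subgroup G (mult_of (residue_ring (int p)))"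
    "G \<noteq> carrier (mult_of (residue_ring (int p)))"
  shows "2 * card G < p"
proof -
  interpret R: residues_prime p "residue_ring (int p)" by unfold_locales (rule p)
  interpret U: group "mult_of (residue_ring (int p))" by (rule R.field_mult_group)
  have fin: "finite (carrier (mult_of (residue_ring (int p))))" by (intro R.finite_mult_of R.finite)
  have "Coset.order (residue_ring (int p)) = p" by (simp add: Coset.order_def R.res_carrier_eq)
  then have order: "Coset.order (mult_of (residue_ring (int p))) = p - 1" by (simp add: R.order_mult_of)
  have "G \<subset> carrier (mult_of (residue_ring (int p)))" using subgroup.subset[OF G(1)] G(2) by blast
  then have "card G < p - 1" using psubset_card_mono[OF fin] order unfolding Coset.order_def by simp
  moreover have "card G dvd p - 1" using U.lagrange[OF G(1)] order by (metis dvd_triv_right)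
  then obtain k where k: "p - 1 = card G * k" by (elim dvdE)
  ultimately have "k \<noteq> 0" "k \<noteq> 1" by (auto intro: ccontr)
  then have "card G * 2 \<le> card G * k" by (intro mult_left_mono) auto
  then show ?thesis using k prime_gt_1_nat[OF p] by linarith
qed

text \<open>The map from the representatives below \<open>CARD('a)\<close> to
  \<open>'a mod_ring\<close> is injective and respects sums and products, so it carries a
  counterexample into the locale \<open>multiplicative_subgroup\<close>.\<close>

lemma not_exceptional_prime: "\<not> exceptional_prime CARD('a::prime_card)"
proof
  let ?R = "residue_ring (int CARD('a))"
  assume "exceptional_prime CARD('a)"
  then obtain G A B C :: "int set" where G: "subgroup G (mult_of ?R)" "G \<noteq> carrier (mult_of ?R)"
    "10 ^ 22 \<le> card G"
    and sub: "A \<subseteq> carrier ?R" "B \<subseteq> carrier ?R" "C \<subseteq> carrier ?R"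
    and card: "card A \<ge> 2" "card B \<ge> 2" "card C \<ge> 2"
    and sum: "G = A <+>\<^bsub>?R\<^esub> B <+>\<^bsub>?R\<^esub> C"
    unfolding exceptional_prime_def by blast
  interpret R: residues_prime "CARD('a)" ?R by unfold_locales (rule prime_card)
  define f :: "int \<Rightarrow> 'a mod_ring" where "f = of_int"
  have f_mod: "f (x mod int CARD('a)) = f x" for x
  proof -
    have "f x = f (x div int CARD('a) * int CARD('a) + x mod int CARD('a))" by simp
    also have "\<dots> = f (x mod int CARD('a))" unfolding f_def of_int_add of_int_mult by simp
    finally show ?thesis by simp
  qed
  have inj: "inj_on f (carrier ?R)"
  proof (rule inj_onI)
    fix x y assume "x \<in> carrier ?R" "y \<in> carrier ?R" "f x = f y"
    then show "x = y"
      unfolding f_def of_int_eq_iff_cong_CHAR by (auto simp: R.res_carrier_eq cong_def)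
  qed
  have card_f: "card (f ` X) = card X" if "X \<subseteq> carrier ?R" for X
    using inj_on_subset[OF inj that] by (rule card_image)
  have G_sub: "G \<subseteq> carrier ?R - {0}"
    using subgroup.subset[OF G(1)] by (simp add: R.res_zero_eq)
  then have card_G: "card (f ` G) = card G" using card_f by blast
  have image_add: "f ` (X <+>\<^bsub>?R\<^esub> Y) = f ` X + f ` Y" for X Y
  proof -
    have "f ((x + y) mod int CARD('a)) = f x + f y" for x y unfolding f_mod by (simp add: f_def)
    then show ?thesis by (auto simp: set_add_def' R.res_add_eq set_plus_def image_UN)
  qed
  have "multiplicative_subgroup (f ` G)"
  proof
    show "prime CHAR('a mod_ring)" by (simp add: prime_card)
    show "finite (f ` G)" by simp
    show "f ` G \<noteq> {}" using G(3) by auto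
    show "0 \<notin> f ` G"
    proof
      assume "0 \<in> f ` G"
      then obtain x where x: "x \<in> G" "f x = f 0" by (auto simp: f_def)
      moreover have "0 \<in> carrier ?R" using R.zero_closed by (simp add: R.res_zero_eq)
      ultimately show False using inj_onD[OF inj] G_sub by blast
    qed
    show "2 * card (f ` G) < CHAR('a mod_ring)"
      using twice_card_proper_subgroup[OF prime_card G(1,2)] card_G by simp
    fix u v assume "u \<in> f ` G" "v \<in> f ` G"
    then obtain x y where xy: "x \<in> G" "y \<in> G" "u = f x" "v = f y" by auto
    have "(x * y) mod int CARD('a) \<in> G"
      using subgroup.m_closed[OF G(1) xy(1,2)] by (simp add: R.res_mult_eq)
    then have "f ((x * y) mod int CARD('a)) \<in> f ` G" by (rule imageI)
    then show "u * v \<in> f ` G" by (simp add: f_mod xy) (simp add: f_def)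
  qed
  then show False
  proof (rule multiplicative_subgroup.no_three_summands)
    show "f ` G = f ` A + f ` B + f ` C" by (simp add: sum image_add)
    show "10 ^ 22 \<le> card (f ` G)" using G(3) card_G by simp
  qed (use card sub card_f in auto)
qed

text \<open>The characteristic is quantified inside the theorem, whereas the field has to be a type.
  The type \<open>witness\<close> below has a prime number of elements, an exceptional one if there is any.\<close>

definition witness_prime :: nat where
  "witness_prime = (if \<exists>p. exceptional_prime p then SOME p. exceptional_prime p else 2)"

lemma exceptional_witness_prime: "exceptional_prime p \<Longrightarrow> exceptional_prime witness_prime"
  unfolding witness_prime_def by (auto intro: someI)

lemma prime_witness_prime: "prime witness_prime"
proof (cases "\<exists>p. exceptional_prime p")
  case True
  then obtain p where "exceptional_prime p" ..
  then show ?thesis using exceptional_witness_prime unfolding exceptional_prime_def by blast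
qed (simp add: witness_prime_def)

typedef witness = "{..<witness_prime}"
  using prime_gt_0_nat[OF prime_witness_prime] by auto

lemma CARD_witness: "CARD(witness) = witness_prime"
  using type_definition.card[OF type_definition_witness] by simp

instance witness :: prime_card
  by standard (simp add: CARD_witness prime_witness_prime)

lemma no_exceptional_prime: "\<not> exceptional_prime p"
  using exceptional_witness_prime not_exceptional_prime[where 'a = witness] by (auto simp: CARD_witness)

theorem theorem1p5:
  shows "\<exists>M::real. M > 0 \<and>
    (\<forall>(p::nat) (G::int set).
      prime p \<longrightarrow>
      subgroup G (mult_of (residue_ring (int p))) \<longrightarrow>
      G \<noteq> carrier (mult_of (residue_ring (int p))) \<longrightarrow>
      real (card G) > M \<longrightarrow>
      \<not> (\<exists>A B C :: int set.
          A \<subseteq> carrier (residue_ring (int p)) \<and>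
          B \<subseteq> carrier (residue_ring (int p)) \<and>
          C \<subseteq> carrier (residue_ring (int p)) \<and>
          card A \<ge> 2 \<and> card B \<ge> 2 \<and> card C \<ge> 2 \<and>
          G = A <+>\<^bsub>residue_ring (int p)\<^esub> B <+>\<^bsub>residue_ring (int p)\<^esub> C))"
proof (intro exI[of _ "10 ^ 22"] conjI allI impI notI)
  fix p :: nat and G :: "int set"
  assume *: "prime p" "subgroup G (mult_of (residue_ring (int p)))"
    "G \<noteq> carrier (mult_of (residue_ring (int p)))" "real (card G) > 10 ^ 22"
    "\<exists>A B C :: int set.
          A \<subseteq> carrier (residue_ring (int p)) \<and>
          B \<subseteq> carrier (residue_ring (int p)) \<and>
          C \<subseteq> carrier (residue_ring (int p)) \<and>
          card A \<ge> 2 \<and> card B \<ge> 2 \<and> card C \<ge> 2 \<and>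
          G = A <+>\<^bsub>residue_ring (int p)\<^esub> B <+>\<^bsub>residue_ring (int p)\<^esub> C"
  have "real (10 ^ 22) < real (card G)" using *(4) by simp
  then have "10 ^ 22 \<le> card G" unfolding of_nat_less_iff by simp
  then have "exceptional_prime p" unfolding exceptional_prime_def using * by blast
  then show False using no_exceptional_prime by blast
qed simp

end
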